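(* Let $\mathcal{E}$ be an irreducible Dirichlet form on $L^2(m)$, let $p\in(1,\infty)$, and let $f\in L^p(m)$ be $L_p$-harmonic. Then $f$ is constant; more precisely, $$f=\begin{cases}\frac{1}{m(X)}\int_X f\,dm & \text{if } m(X)<\infty \text{ and } \mathcal{E} \text{ is conservative},\\ 0 & \text{otherwise.}\end{cases}$$ In particular, if there is a non-zero $L_p$-harmonic function for some $p\in(1,\infty)$, then $m(X)<\infty$.
   Context: $(X,\mathcal{B},m)$ is a $\sigma$-finite measure space and $\mathcal{E}$ is a (symmetric) Dirichlet form on $L^2(m)$, i.e. a closed, densely defined, nonnegative symmetric quadratic form with the Markov property ($\mathcal{E}(C\circ f)\le \mathcal{E}(f)$ for every normal contraction $C$). Let $L\ge 0$ be the associated self-adjoint operator and $T_t=e^{-tL}$ the associated Markovian semigroup. For $p\in[1,\infty)$ the semigroup extends consistently to a $C_0$-semigroup of contractions $(T_t)$ on $L^p(m)$ (the extensions agree on $L^p\cap L^q$); its generator is denoted $L_p$ (with sign convention $T_t=e^{-tL_p}$). A function $f\in L^p(m)$ is called $L_p$-harmonic if $f\in D(L_p)$ and $L_pf=0$. A measurable set $A$ is $\mathcal{E}$-invariant if $T_t(1_A f)=1_A T_t f$ for all $f\in L^2(m)$, $t\ge0$; $\mathcal{E}$ is irreducible if every $\mathcal{E}$-invariant set $A$ satisfies $m(A)=0$ or $m(X\setminus A)=0$. $\mathcal{E}$ is conservative if $T_t1=1$ for all $t\ge0$ (with $T_t$ extended to $L^\infty(m)$). *)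

theory Defs
  imports "HOL-Analysis.Analysis"
begin

section \<open>L^p spaces on representatives (real-valued functions, identified a.e.)\<close>

definition memLp :: "'a measure \<Rightarrow> real \<Rightarrow> ('a \<Rightarrow> real) \<Rightarrow> bool" where
  "memLp M p f \<longleftrightarrow> f \<in> borel_measurable M \<and> integrable M (\<lambda>x. \<bar>f x\<bar> powr p)"

definition Lpnorm :: "'a measure \<Rightarrow> real \<Rightarrow> ('a \<Rightarrow> real) \<Rightarrow> real" where
  "Lpnorm M p f = (\<integral>x. \<bar>f x\<bar> powr p \<partial>M) powr (1 / p)"

definition normal_contraction :: "(real \<Rightarrow> real) \<Rightarrow> bool" where
  "normal_contraction C \<longleftrightarrow> C 0 = 0 \<and> (\<forall>a b. \<bar>C a - C b\<bar> \<le> \<bar>a - b\<bar>)"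

text \<open>A Dirichlet form on L^2(M) given by its domain D and its (symmetric bilinear) form B;
  the quadratic form is E(f) = B f f. Closed, densely defined, nonnegative, symmetric,
  Markovian.\<close>
definition dirichlet_form ::
  "'a measure \<Rightarrow> ('a \<Rightarrow> real) set \<Rightarrow> (('a \<Rightarrow> real) \<Rightarrow> ('a \<Rightarrow> real) \<Rightarrow> real) \<Rightarrow> bool" where
  "dirichlet_form M D B \<longleftrightarrow>
     \<comment> \<open>D is a subspace of L^2, closed under a.e. equality, B well-defined on classes\<close>
     (\<forall>f\<in>D. memLp M 2 f) \<and>
     (\<lambda>x. 0) \<in> D \<and>
     (\<forall>f\<in>D. \<forall>g\<in>D. \<forall>a b. (\<lambda>x. a * f x + b * g x) \<in> D) \<and>
     (\<forall>f\<in>D. \<forall>g. memLp M 2 g \<and> (AE x in M. f x = g x) \<longrightarrow>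
         g \<in> D \<and> (\<forall>h\<in>D. B g h = B f h \<and> B h g = B h f)) \<and>
     \<comment> \<open>symmetric bilinear\<close>
     (\<forall>f\<in>D. \<forall>g\<in>D. B f g = B g f) \<and>
     (\<forall>f\<in>D. \<forall>g\<in>D. \<forall>h\<in>D. \<forall>a b. B (\<lambda>x. a * f x + b * g x) h = a * B f h + b * B g h) \<and>
     \<comment> \<open>nonnegative\<close>
     (\<forall>f\<in>D. 0 \<le> B f f) \<and>
     \<comment> \<open>densely defined\<close>
     (\<forall>f. memLp M 2 f \<longrightarrow> (\<forall>e>0. \<exists>g\<in>D. Lpnorm M 2 (\<lambda>x. f x - g x) < e)) \<and>
     \<comment> \<open>closed: D is complete for the norm (E(u) + ||u||_2^2)^(1/2)\<close>
     (\<forall>u :: nat \<Rightarrow> 'a \<Rightarrow> real. (\<forall>n. u n \<in> D) \<longrightarrow>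
        (\<forall>e>0. \<exists>N. \<forall>n\<ge>N. \<forall>m\<ge>N.
            B (\<lambda>x. u n x - u m x) (\<lambda>x. u n x - u m x) + (Lpnorm M 2 (\<lambda>x. u n x - u m x))\<^sup>2 < e) \<longrightarrow>
        (\<exists>v\<in>D. (\<lambda>n. B (\<lambda>x. u n x - v x) (\<lambda>x. u n x - v x) + (Lpnorm M 2 (\<lambda>x. u n x - v x))\<^sup>2)
                  \<longlonglongrightarrow> 0)) \<and>
     \<comment> \<open>Markov property\<close>
     (\<forall>C f. normal_contraction C \<and> f \<in> D \<longrightarrow> (C \<circ> f) \<in> D \<and> B (C \<circ> f) (C \<circ> f) \<le> B f f)"

definition sym_C0_contraction_sg :: "'a measure \<Rightarrow> (real \<Rightarrow> ('a \<Rightarrow> real) \<Rightarrow> ('a \<Rightarrow> real)) \<Rightarrow> bool" where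
  "sym_C0_contraction_sg M T \<longleftrightarrow>
     (\<forall>t\<ge>0. \<forall>f. memLp M 2 f \<longrightarrow> memLp M 2 (T t f)) \<and>
     (\<forall>t\<ge>0. \<forall>f g. memLp M 2 f \<and> memLp M 2 g \<and> (AE x in M. f x = g x) \<longrightarrow>
         (AE x in M. T t f x = T t g x)) \<and>
     (\<forall>t\<ge>0. \<forall>f g a b. memLp M 2 f \<and> memLp M 2 g \<longrightarrow>
         (AE x in M. T t (\<lambda>y. a * f y + b * g y) x = a * T t f x + b * T t g x)) \<and>
     (\<forall>t\<ge>0. \<forall>f. memLp M 2 f \<longrightarrow> Lpnorm M 2 (T t f) \<le> Lpnorm M 2 f) \<and>
     (\<forall>f. memLp M 2 f \<longrightarrow> (AE x in M. T 0 f x = f x)) \<and>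
     (\<forall>s\<ge>0. \<forall>t\<ge>0. \<forall>f. memLp M 2 f \<longrightarrow> (AE x in M. T (s + t) f x = T s (T t f) x)) \<and>
     (\<forall>f. memLp M 2 f \<longrightarrow> ((\<lambda>t. Lpnorm M 2 (\<lambda>x. T t f x - f x)) \<longlongrightarrow> 0) (at_right 0)) \<and>
     (\<forall>t\<ge>0. \<forall>f g. memLp M 2 f \<and> memLp M 2 g \<longrightarrow>
         (\<integral>x. T t f x * g x \<partial>M) = (\<integral>x. f x * T t g x \<partial>M))"

text \<open>T is the semigroup e^{-tL} associated with the closed form (D,B): T is a symmetric
  C_0 contraction semigroup on L^2 and, for f in L^2,
  f \<in> D iff lim_{t\<rightarrow>0+} (1/t) (f - T_t f, f) exists (finitely), and then E(f) is this limit.\<close>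
definition associated_semigroup ::
  "'a measure \<Rightarrow> ('a \<Rightarrow> real) set \<Rightarrow> (('a \<Rightarrow> real) \<Rightarrow> ('a \<Rightarrow> real) \<Rightarrow> real)
     \<Rightarrow> (real \<Rightarrow> ('a \<Rightarrow> real) \<Rightarrow> ('a \<Rightarrow> real)) \<Rightarrow> bool" where
  "associated_semigroup M D B T \<longleftrightarrow>
     sym_C0_contraction_sg M T \<and>
     (\<forall>f. memLp M 2 f \<longrightarrow>
        (f \<in> D \<longleftrightarrow> (\<exists>c. ((\<lambda>t. (\<integral>x. (f x - T t f x) * f x \<partial>M) / t) \<longlongrightarrow> c) (at_right 0)))) \<and>
     (\<forall>f\<in>D. ((\<lambda>t. (\<integral>x. (f x - T t f x) * f x \<partial>M) / t) \<longlongrightarrow> B f f) (at_right 0))"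

text \<open>Tp is the (consistent) extension of the L^2 semigroup T to L^p: bounded linear operators on
  L^p agreeing a.e. with T on L^p \<inter> L^2 (it is unique since L^p \<inter> L^2 is dense in L^p).\<close>
definition Lp_extension ::
  "'a measure \<Rightarrow> real \<Rightarrow> (real \<Rightarrow> ('a \<Rightarrow> real) \<Rightarrow> ('a \<Rightarrow> real))
     \<Rightarrow> (real \<Rightarrow> ('a \<Rightarrow> real) \<Rightarrow> ('a \<Rightarrow> real)) \<Rightarrow> bool" where
  "Lp_extension M p T Tp \<longleftrightarrow>
     (\<forall>t\<ge>0. \<forall>f. memLp M p f \<longrightarrow> memLp M p (Tp t f)) \<and>
     (\<forall>t\<ge>0. \<forall>f g a b. memLp M p f \<and> memLp M p g \<longrightarrow>
         (AE x in M. Tp t (\<lambda>y. a * f y + b * g y) x = a * Tp t f x + b * Tp t g x)) \<and>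
     (\<forall>t\<ge>0. \<exists>K. \<forall>f. memLp M p f \<longrightarrow> Lpnorm M p (Tp t f) \<le> K * Lpnorm M p f) \<and>
     (\<forall>t\<ge>0. \<forall>f. memLp M p f \<and> memLp M 2 f \<longrightarrow> (AE x in M. Tp t f x = T t f x))"

text \<open>f is L_p-harmonic: f \<in> D(L_p) and L_p f = 0, where L_p f = lim_{t\<rightarrow>0+} (f - T_t f)/t in L^p.\<close>
definition Lp_harmonic ::
  "'a measure \<Rightarrow> real \<Rightarrow> (real \<Rightarrow> ('a \<Rightarrow> real) \<Rightarrow> ('a \<Rightarrow> real)) \<Rightarrow> ('a \<Rightarrow> real) \<Rightarrow> bool" where
  "Lp_harmonic M p Tp f \<longleftrightarrow>
     memLp M p f \<and> ((\<lambda>t. Lpnorm M p (\<lambda>x. (f x - Tp t f x) / t)) \<longlongrightarrow> 0) (at_right 0)"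

definition invariant_set :: "'a measure \<Rightarrow> (real \<Rightarrow> ('a \<Rightarrow> real) \<Rightarrow> ('a \<Rightarrow> real)) \<Rightarrow> 'a set \<Rightarrow> bool" where
  "invariant_set M T A \<longleftrightarrow> A \<in> sets M \<and>
     (\<forall>t\<ge>0. \<forall>f. memLp M 2 f \<longrightarrow>
        (AE x in M. T t (\<lambda>y. indicator A y * f y) x = indicator A x * T t f x))"

definition irreducible :: "'a measure \<Rightarrow> (real \<Rightarrow> ('a \<Rightarrow> real) \<Rightarrow> ('a \<Rightarrow> real)) \<Rightarrow> bool" where
  "irreducible M T \<longleftrightarrow>
     (\<forall>A. invariant_set M T A \<longrightarrow> emeasure M A = 0 \<or> emeasure M (space M - A) = 0)"

text \<open>Conservative: T_t 1 = 1 for the L^\<infinity> extension of T_t, which is the adjoint of the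
  L^1 extension T^1_t; i.e. \<integral> (T^1_t g) = \<integral> g for all g \<in> L^1.\<close>
definition conservative :: "'a measure \<Rightarrow> (real \<Rightarrow> ('a \<Rightarrow> real) \<Rightarrow> ('a \<Rightarrow> real)) \<Rightarrow> bool" where
  "conservative M T \<longleftrightarrow>
     (\<forall>T1. Lp_extension M 1 T T1 \<longrightarrow>
        (\<forall>t\<ge>0. \<forall>g. memLp M 1 g \<longrightarrow> (\<integral>x. T1 t g x \<partial>M) = (\<integral>x. g x \<partial>M)))"

end

theory Submission
  imports Defs
begin

text \<open>
  The functions \<open>t \<mapsto> (T\<^sub>t f, f)\<close> are convex, so they have right derivatives at positive times and
  \<open>T\<^sub>s\<close> maps \<open>L\<^sup>2\<close> into the form domain for \<open>s > 0\<close>. Along the semigroup the squared norm of \<open>(T\<^sub>t f - 1)\<^sup>+\<close>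
  then has right derivative at most \<open>-2 B(T\<^sub>t f, (T\<^sub>t f - 1)\<^sup>+)\<close>, which the Markov property makes
  nonpositive. Hence \<open>T\<^sub>t\<close> is sub-Markovian, and by symmetry a contraction on \<open>L\<^sup>1\<close>.

  If \<open>f\<close> is \<open>L\<^sub>p\<close>-harmonic, pairing \<open>f\<close> with \<open>T\<^sub>t w\<close> is independent of \<open>t\<close> for \<open>w\<close> in \<open>L\<^sup>1 \<inter> L\<^sup>\<infinity>\<close>. Taking
  \<open>w = 1\<^sub>A\<close> for \<open>A = {f > c}\<close>, \<open>c > 0\<close>, this forces \<open>T\<^sub>t 1\<^sub>A = 1\<^sub>A\<close>, so \<open>A\<close> is invariant and hence
  null or conull. Therefore \<open>f\<close> is constant, and if \<open>f\<close> is not zero then some conull \<open>A\<close> has finite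
  measure and \<open>T\<^sub>t 1 = 1\<close>, which is conservativeness.
\<close>

section \<open>Convexity and Dini derivatives\<close>

text \<open>Subtracting the chord over \<open>[a, b]\<close> leaves a continuous, midpoint convex
  \<open>d\<close> that vanishes at both ends. At a maximum point \<open>x\<close> the midpoint
  inequality for an endpoint and its mirror image gives \<open>2 * d x <= d x\<close>, so
  \<open>d\<close> is nonpositive throughout.\<close>

lemma midpoint_convex_imp_convex_on:
  fixes F :: "real \<Rightarrow> real"
  assumes cont: "continuous_on {0..} F"
    and mid: "\<And>s t. 0 \<le> s \<Longrightarrow> 0 \<le> t \<Longrightarrow> 2 * F ((s + t) / 2) \<le> F s + F t"
  shows "convex_on {0..} F"
proof (rule convex_on_linorderI)
  show "convex {0::real..}" by simp
  fix l a b :: real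
  assume l: "0 < l" "l < 1" and ab: "a \<in> {0..}" "b \<in> {0..}" "a < b"
  define k where "k = (F b - F a) / (b - a)"
  define d where "d x = F x - (F a + k * (x - a))" for x
  have d0: "d a = 0" "d b = 0"
    using ab by (auto simp: d_def k_def)
  have "continuous_on {a..b} d"
    unfolding d_def using ab by (intro continuous_intros continuous_on_subset[OF cont]) auto
  then obtain x where x: "x \<in> {a..b}" "\<And>y. y \<in> {a..b} \<Longrightarrow> d y \<le> d x"
    using continuous_attains_sup[of "{a..b}" d] ab by auto
  have dmid: "2 * d ((s + t) / 2) \<le> d s + d t" if "s \<in> {a..b}" "t \<in> {a..b}" for s t
  proof -
    have "2 * F ((s + t) / 2) \<le> F s + F t" using mid that ab by auto
    moreover have "2 * d ((s + t) / 2) = 2 * F ((s + t) / 2) - 2 * F a - (k * s + k * t - 2 * k * a)"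
      by (simp add: d_def field_simps)
    moreover have "d s + d t = F s + F t - 2 * F a - (k * s + k * t - 2 * k * a)"
      by (simp add: d_def algebra_simps)
    ultimately show ?thesis by linarith
  qed
  \<comment> \<open>Reflect the nearer endpoint, where \<open>d\<close> vanishes, in the maximum point \<open>x\<close>.\<close>
  have "d x \<le> 0"
  proof (cases "x - a \<le> b - x")
    case True
    with x have "2 * d ((a + (2 * x - a)) / 2) \<le> d a + d (2 * x - a)"
      by (intro dmid) auto
    moreover have "d (2 * x - a) \<le> d x" using x True by auto
    ultimately show ?thesis using d0 by simp
  next
    case False
    with x have "2 * d (((2 * x - b) + b) / 2) \<le> d (2 * x - b) + d b"
      by (intro dmid) auto
    moreover have "d (2 * x - b) \<le> d x" using x False by auto
    ultimately show ?thesis using d0 by simp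
  qed
  moreover have "(1 - l) * a + l * b = a + l * (b - a)" by (simp add: algebra_simps)
  moreover have "a + l * (b - a) \<in> {a..b}"
  proof -
    have "l * (b - a) \<le> b - a" "0 \<le> l * (b - a)"
      using l ab by (auto intro!: mult_left_le_one_le)
    then show ?thesis unfolding atLeastAtMost_iff by linarith
  qed
  ultimately have "d ((1 - l) * a + l * b) \<le> 0" using x(2) by fastforce
  moreover have "k * (((1 - l) * a + l * b) - a) = l * (F b - F a)"
    using ab by (simp add: k_def divide_simps) (simp add: algebra_simps)
  ultimately show "F ((1 - l) *\<^sub>R a + l *\<^sub>R b) \<le> (1 - l) * F a + l * F b"
    unfolding d_def by (simp add: algebra_simps)
qed

text \<open>The difference quotients increase with \<open>h\<close> and are bounded below by the
  slope of the chord from 0 to \<open>x\<close>, which exists because \<open>x\<close> is positive.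
  Their infimum is the limit.\<close>

lemma convex_on_right_derivative_exists:
  fixes F :: "real \<Rightarrow> real"
  assumes F: "convex_on {0..} F" and "0 < x"
  shows "\<exists>c. ((\<lambda>h. (F (x + h) - F x) / h) \<longlongrightarrow> c) (at_right 0)"
proof -
  define q where "q h = (F (x + h) - F x) / h" for h
  have mono: "q h \<le> q k" if "0 < h" "h \<le> k" for h k
  proof (cases "h = k")
    case False
    then have "(F x - F (x + h)) / (x - (x + h)) \<le> (F x - F (x + k)) / (x - (x + k))"
      using that assms by (intro convex_on_slope_le(1)[OF F]) auto
    then show ?thesis by (simp add: q_def minus_divide_left)
  qed simp
  have bound: "(F 0 - F x) / (0 - x) \<le> q h" if "0 < h" for h
  proof -
    have "(F 0 - F x) / (0 - x) \<le> (F 0 - F (x + h)) / (0 - (x + h))"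
      using that assms by (intro convex_on_slope_le(1)[OF F]) auto
    also have "\<dots> \<le> (F x - F (x + h)) / (x - (x + h))"
      using that assms by (intro convex_on_slope_le(2)[OF F]) auto
    finally show ?thesis by (simp add: q_def minus_divide_left)
  qed
  define c where "c = Inf (q ` {0<..})"
  have bdd: "bdd_below (q ` {0<..})"
    by (rule bdd_belowI2[where m="(F 0 - F x) / (0 - x)"]) (use bound in auto)
  have "(q \<longlongrightarrow> c) (at_right 0)"
  proof (rule order_tendstoI)
    fix y assume "y < c"
    then have "y < q h" if "0 < h" for h
      using cInf_lower[OF imageI bdd, of h] that by (auto simp: c_def)
    then show "\<forall>\<^sub>F h in at_right 0. y < q h"
      by (auto simp: eventually_at_right_field intro!: exI[of _ 1])
  next
    fix y assume "c < y"
    then obtain k where k: "0 < k" "q k < y"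
      using cInf_less_iff[OF _ bdd, of y] by (auto simp: c_def)
    then have "q h < y" if "0 < h" "h < k" for h
      using mono[of h k] that by auto
    then show "\<forall>\<^sub>F h in at_right 0. q h < y"
      using k by (auto simp: eventually_at_right_field)
  qed
  then show ?thesis unfolding q_def by blast
qed

text \<open>For slope \<open>e\<close> and start \<open>a\<close>, let \<open>x\<close> be the last
  point in \<open>[a, t]\<close> with \<open>F x <= F a + e * (x - a)\<close>. If
  \<open>x < t\<close>, the hypothesis at \<open>x\<close> carries the bound beyond
  \<open>x\<close>. Then \<open>e\<close> tends to 0, and finally \<open>a\<close> does, by
  continuity, since the hypothesis concerns positive times only.\<close>

lemma right_Dini_nonpos_imp_le:
  fixes F :: "real \<Rightarrow> real"
  assumes cont: "continuous_on {0..} F"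
    and dini: "\<And>s e. 0 < s \<Longrightarrow> 0 < e \<Longrightarrow> \<forall>\<^sub>F h in at_right 0. F (s + h) \<le> F s + e * h"
    and t: "0 \<le> t"
  shows "F t \<le> F 0"
proof -
  have pos: "F t \<le> F a + e * (t - a)" if a: "0 < a" "a < t" and e: "0 < e" for a e
  proof (rule ccontr)
    assume neg: "\<not> ?thesis"
    define S where "S = {x \<in> {a..t}. F x - e * x \<le> F a - e * a}"
    define x where "x = Sup S"
    have cl: "closed S"
      unfolding S_def
      by (rule continuous_on_closed_Collect_le)
        (use a in \<open>auto intro!: continuous_intros continuous_on_subset[OF cont]\<close>)
    have aS: "a \<in> S" and bdd: "bdd_above S" using a by (auto simp: S_def bdd_above_def)
    have "x \<in> S" unfolding x_def using aS bdd cl by (intro closed_contains_Sup) auto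
    with neg have x: "a \<le> x" "x < t" "F x - e * x \<le> F a - e * a"
      by (auto simp: S_def algebra_simps order.order_iff_strict)
    obtain b where b: "b > 0" "\<And>h. 0 < h \<Longrightarrow> h < b \<Longrightarrow> F (x + h) \<le> F x + e * h"
      using dini[of x e] x a e by (auto simp: eventually_at_right_field)
    define h where "h = min (b / 2) (t - x)"
    have h: "0 < h" "h < b" "x + h \<le> t" using b x by (auto simp: h_def)
    then have "x + h \<in> S" using b(2)[of h] x by (auto simp: S_def algebra_simps)
    then have "x + h \<le> x" unfolding x_def using bdd by (rule cSup_upper)
    with h show False by simp
  qed
  have pos': "F t \<le> F a" if a: "0 < a" "a < t" for a
  proof (rule field_le_epsilon)
    fix e :: real assume "0 < e"
    then show "F t \<le> F a + e" using pos[OF a, of "e / (t - a)"] a by simp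
  qed
  show ?thesis
  proof (cases "t = 0")
    case False
    have "(F \<longlongrightarrow> F 0) (at 0 within {0..})"
      using cont by (simp add: continuous_on_def)
    then have "(F \<longlongrightarrow> F 0) (at_right 0)"
      by (rule tendsto_within_subset) auto
    then show ?thesis
    proof (rule tendsto_lowerbound)
      show "\<forall>\<^sub>F a in at_right 0. F t \<le> F a"
        using pos' t False by (auto simp: eventually_at_right_field intro!: exI[of _ t])
    qed simp
  qed simp
qed

section \<open>Integration lemmas\<close>

lemma memLp_measurable [measurable_dest]: "memLp M p f \<Longrightarrow> f \<in> borel_measurable M"
  by (simp add: memLp_def)

lemma memLp_bound:
  assumes "memLp M p g" "f \<in> borel_measurable M" "AE x in M. \<bar>f x\<bar> \<le> \<bar>g x\<bar>" "0 \<le> p"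
  shows "memLp M p f"
  unfolding memLp_def
proof
  show "integrable M (\<lambda>x. \<bar>f x\<bar> powr p)"
  proof (rule Bochner_Integration.integrable_bound)
    show "integrable M (\<lambda>x. \<bar>g x\<bar> powr p)" using assms by (simp add: memLp_def)
    show "AE x in M. norm (\<bar>f x\<bar> powr p) \<le> norm (\<bar>g x\<bar> powr p)"
      using assms(3) by eventually_elim (use assms(4) in \<open>auto intro: powr_mono2\<close>)
  qed (use assms in auto)
qed fact

lemma memLp_scale: "memLp M p f \<Longrightarrow> memLp M p (\<lambda>x. c * f x)"
  by (auto simp: memLp_def abs_mult powr_mult)

text \<open>The crude bound through \<open>2 * max\<close> holds for every \<open>p >= 0\<close> and
  takes the place of the Minkowski inequality.\<close>

lemma memLp_diff:
  assumes "memLp M p f" "memLp M p g" "0 \<le> p"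
  shows "memLp M p (\<lambda>x. f x - g x)"
  unfolding memLp_def
proof
  show m: "(\<lambda>x. f x - g x) \<in> borel_measurable M" using assms by (auto simp: memLp_def)
  have le: "\<bar>a - b\<bar> powr p \<le> 2 powr p * (\<bar>a\<bar> powr p + \<bar>b\<bar> powr p)" for a b :: real
  proof -
    have "\<bar>a - b\<bar> powr p \<le> (2 * max \<bar>a\<bar> \<bar>b\<bar>) powr p"
      using \<open>0 \<le> p\<close> by (intro powr_mono2) auto
    also have "\<dots> = 2 powr p * (max \<bar>a\<bar> \<bar>b\<bar>) powr p" by (simp add: powr_mult)
    also have "\<dots> \<le> 2 powr p * (\<bar>a\<bar> powr p + \<bar>b\<bar> powr p)"
      by (intro mult_left_mono) (auto simp: max_def)
    finally show ?thesis .
  qed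
  show "integrable M (\<lambda>x. \<bar>f x - g x\<bar> powr p)"
  proof (rule Bochner_Integration.integrable_bound)
    show "integrable M (\<lambda>x. 2 powr p * (\<bar>f x\<bar> powr p + \<bar>g x\<bar> powr p))"
      using assms by (simp add: memLp_def)
    show "AE x in M. norm (\<bar>f x - g x\<bar> powr p) \<le> norm (2 powr p * (\<bar>f x\<bar> powr p + \<bar>g x\<bar> powr p))"
      using le by simp
  qed (use m in auto)
qed

lemma memLp2_iff: "memLp M 2 f \<longleftrightarrow> f \<in> borel_measurable M \<and> integrable M (\<lambda>x. (f x)\<^sup>2)"
  by (simp add: memLp_def)

lemma Lpnorm_2: "Lpnorm M 2 f = sqrt (\<integral>x. (f x)\<^sup>2 \<partial>M)"
  by (simp add: Lpnorm_def powr_half_sqrt)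

lemma memLp2_mult_integrable:
  assumes "memLp M 2 f" "memLp M 2 g"
  shows "integrable M (\<lambda>x. f x * g x)"
proof (rule Bochner_Integration.integrable_bound)
  show "integrable M (\<lambda>x. (f x)\<^sup>2 + (g x)\<^sup>2)"
    using assms by (simp add: memLp2_iff)
  show "(\<lambda>x. f x * g x) \<in> borel_measurable M"
    using assms by (auto simp: memLp2_iff)
  have "\<bar>a * b\<bar> \<le> a\<^sup>2 + b\<^sup>2" for a b :: real
    using zero_le_power2[of "a + b"] zero_le_power2[of "a - b"] zero_le_power2[of a] zero_le_power2[of b]
    unfolding power2_sum power2_diff by (auto simp: abs_if)
  then show "AE x in M. norm (f x * g x) \<le> norm ((f x)\<^sup>2 + (g x)\<^sup>2)"
    by auto
qed

lemma memLp2_bound: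
  "memLp M 2 g \<Longrightarrow> f \<in> borel_measurable M \<Longrightarrow> AE x in M. \<bar>f x\<bar> \<le> \<bar>g x\<bar> \<Longrightarrow> memLp M 2 f"
  by (rule memLp_bound) auto

lemma memLp2_lincomb:
  assumes "memLp M 2 f" "memLp M 2 g"
  shows "memLp M 2 (\<lambda>x. a * f x + b * g x)"
  unfolding memLp2_iff
proof
  have "(\<lambda>x. (a * f x + b * g x)\<^sup>2) = (\<lambda>x. a\<^sup>2 * (f x)\<^sup>2 + b\<^sup>2 * (g x)\<^sup>2 + 2 * a * b * (f x * g x))"
    by (auto simp: power2_eq_square algebra_simps)
  then show "integrable M (\<lambda>x. (a * f x + b * g x)\<^sup>2)"
    using assms memLp2_mult_integrable[OF assms] by (simp add: memLp2_iff)
qed (use assms in \<open>auto simp: memLp2_iff\<close>)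

lemma memLp2_diff: "memLp M 2 f \<Longrightarrow> memLp M 2 g \<Longrightarrow> memLp M 2 (\<lambda>x. f x - g x)"
  by (rule memLp_diff) auto

lemma memLp2_indicator:
  "A \<in> sets M \<Longrightarrow> emeasure M A < \<infinity> \<Longrightarrow> memLp M 2 (indicator A)"
  by (simp add: memLp2_iff power2_eq_square flip: indicator_inter_arith)

lemma memLp2_indicator_mult:
  assumes "memLp M 2 f" "A \<in> sets M"
  shows "memLp M 2 (\<lambda>x. indicator A x * f x)"
  by (rule memLp2_bound[OF assms(1)])
    (use assms in \<open>auto simp: memLp2_iff abs_mult indicator_def\<close>)

lemma memLp2_abs: "memLp M 2 f \<Longrightarrow> memLp M 2 (\<lambda>x. \<bar>f x\<bar>)"
  by (rule memLp2_bound) (auto simp: memLp2_iff)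

text \<open>Young's inequality with a free weight \<open>e\<close>, from the squares of
  \<open>a - e * b\<close> and \<open>a + e * b\<close>. The weight allows one factor to be made
  small at the expense of the other, as in limit arguments below.\<close>

lemma memLp2_mult_le:
  assumes "memLp M 2 f" "memLp M 2 g" "0 < e"
  shows "2 * \<bar>\<integral>x. f x * g x \<partial>M\<bar> \<le> (\<integral>x. (f x)\<^sup>2 \<partial>M) / e + e * (\<integral>x. (g x)\<^sup>2 \<partial>M)"
proof -
  have *: "2 * \<bar>a * b\<bar> \<le> a\<^sup>2 / e + e * b\<^sup>2" for a b :: real
  proof -
    have "0 \<le> (a - e * b)\<^sup>2" "0 \<le> (a + e * b)\<^sup>2" by auto
    then have "2 * \<bar>a * b\<bar> * e \<le> a\<^sup>2 + (e * b)\<^sup>2" using \<open>0 < e\<close>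
      unfolding power2_sum power2_diff by (auto simp: abs_if algebra_simps)
    then show ?thesis using \<open>0 < e\<close> by (simp add: field_simps power2_eq_square)
  qed
  have "2 * \<bar>\<integral>x. f x * g x \<partial>M\<bar> \<le> 2 * (\<integral>x. \<bar>f x * g x\<bar> \<partial>M)"
    using integral_abs_bound[of M "\<lambda>x. f x * g x"] by simp
  also have "\<dots> = (\<integral>x. 2 * \<bar>f x * g x\<bar> \<partial>M)" by simp
  also have "\<dots> \<le> (\<integral>x. (f x)\<^sup>2 / e + e * (g x)\<^sup>2 \<partial>M)"
    using assms * memLp2_mult_integrable[OF assms(1,2)]
    by (intro integral_mono) (auto simp: memLp2_iff)
  also have "\<dots> = (\<integral>x. (f x)\<^sup>2 \<partial>M) / e + e * (\<integral>x. (g x)\<^sup>2 \<partial>M)"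
    using assms by (simp add: memLp2_iff)
  finally show ?thesis .
qed

lemma tendsto_integral_mult_L2:
  assumes u: "\<forall>\<^sub>F i in F. memLp M 2 (u i)" and g: "memLp M 2 g"
    and lim: "((\<lambda>i. \<integral>x. (u i x)\<^sup>2 \<partial>M) \<longlongrightarrow> 0) F"
  shows "((\<lambda>i. \<integral>x. u i x * g x \<partial>M) \<longlongrightarrow> 0) F"
proof (rule tendstoI)
  fix \<delta> :: real assume "0 < \<delta>"
  define N where "N = (\<integral>x. (g x)\<^sup>2 \<partial>M)"
  have N: "0 \<le> N" by (simp add: N_def)
  \<comment> \<open>The summand 1 keeps the denominator positive when \<open>g\<close> is zero
    almost everywhere. The weight is fixed before the limit is taken.\<close>
  define e where "e = \<delta> / (N + 1)"
  have e: "0 < e" "e * N \<le> \<delta>"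
    using N \<open>0 < \<delta>\<close> by (auto simp: e_def field_simps)
  have "\<forall>\<^sub>F i in F. (\<integral>x. (u i x)\<^sup>2 \<partial>M) < \<delta> * e"
    using lim \<open>0 < \<delta>\<close> e by (intro order_tendstoD(2)) auto
  with u show "\<forall>\<^sub>F i in F. dist (\<integral>x. u i x * g x \<partial>M) 0 < \<delta>"
  proof eventually_elim
    case (elim i)
    have "(\<integral>x. (u i x)\<^sup>2 \<partial>M) / e < \<delta>" using elim e by (simp add: field_simps)
    then show ?case using memLp2_mult_le[OF elim(1) g e(1)] e by (simp add: N_def)
  qed
qed

text \<open>A second order Taylor bound: the square of the excess over 1 has derivative
  \<open>2 * max (a - 1) 0\<close>, which is Lipschitz with constant 2, so the remainder is at most
  \<open>(b - a)^2\<close>.\<close>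

lemma excess_sq_le:
  fixes a b :: real
  shows "(max (b - 1) 0)\<^sup>2 \<le> (max (a - 1) 0)\<^sup>2 + 2 * ((b - a) * max (a - 1) 0) + (b - a)\<^sup>2"
proof (cases "a \<le> 1"; cases "b \<le> 1")
  assume "a \<le> 1" "\<not> b \<le> 1"
  then have "(b - 1)\<^sup>2 \<le> (b - a)\<^sup>2" by (intro power_mono) auto
  with \<open>a \<le> 1\<close> \<open>\<not> b \<le> 1\<close> show ?thesis by simp
next
  assume "\<not> a \<le> 1" "b \<le> 1"
  then have "max (a - 1) 0 = a - 1" "max (b - 1) 0 = 0" by auto
  moreover have "(a - 1)\<^sup>2 + 2 * ((b - a) * (a - 1)) + (b - a)\<^sup>2 = (b - 1)\<^sup>2"
    by (simp add: power2_eq_square algebra_simps)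
  ultimately show ?thesis by simp
next
  assume "\<not> a \<le> 1" "\<not> b \<le> 1"
  then have "max (a - 1) 0 = a - 1" "max (b - 1) 0 = b - 1" by auto
  then show ?thesis by (simp add: power2_eq_square algebra_simps)
qed simp

lemma memLp2_excess:
  assumes "memLp M 2 f"
  shows "memLp M 2 (\<lambda>x. max (f x - 1) 0)"
  by (rule memLp2_bound[OF assms]) (use assms in \<open>auto simp: memLp2_iff max_def\<close>)

lemma integral_excess_sq_le:
  assumes "memLp M 2 a" "memLp M 2 b"
  shows "(\<integral>x. (max (b x - 1) 0)\<^sup>2 \<partial>M) \<le> (\<integral>x. (max (a x - 1) 0)\<^sup>2 \<partial>M) +
      2 * (\<integral>x. (b x - a x) * max (a x - 1) 0 \<partial>M) + (\<integral>x. (b x - a x)\<^sup>2 \<partial>M)"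
proof -
  note m = memLp2_excess[OF assms(1)] memLp2_excess[OF assms(2)] memLp2_diff[OF assms(2,1)]
  have "(\<integral>x. (max (b x - 1) 0)\<^sup>2 \<partial>M) \<le>
      (\<integral>x. (max (a x - 1) 0)\<^sup>2 + 2 * ((b x - a x) * max (a x - 1) 0) + (b x - a x)\<^sup>2 \<partial>M)"
    using m memLp2_mult_integrable[OF m(3,1)] by (intro integral_mono excess_sq_le) (auto simp: memLp2_iff)
  also have "\<dots> = (\<integral>x. (max (a x - 1) 0)\<^sup>2 \<partial>M) +
      2 * (\<integral>x. (b x - a x) * max (a x - 1) 0 \<partial>M) + (\<integral>x. (b x - a x)\<^sup>2 \<partial>M)"
    using m memLp2_mult_integrable[OF m(3,1)] by (simp add: memLp2_iff)
  finally show ?thesis .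
qed

text \<open>The cross term is absorbed by Young's inequality. In this form the bound yields
  continuity in time of the squared norm of the excess along the semigroup.\<close>

lemma integral_excess_sq_le_epsilon:
  assumes "memLp M 2 a" "memLp M 2 b" "0 < e"
  shows "(\<integral>x. (max (b x - 1) 0)\<^sup>2 \<partial>M) \<le> (\<integral>x. (max (a x - 1) 0)\<^sup>2 \<partial>M) +
      e * (\<integral>x. (a x)\<^sup>2 \<partial>M) + (1 + 1 / e) * (\<integral>x. (b x - a x)\<^sup>2 \<partial>M)"
proof -
  note m = memLp2_excess[OF assms(1)] memLp2_diff[OF assms(2,1)]
  have "(max (a x - 1) 0)\<^sup>2 \<le> (a x)\<^sup>2" for x
    unfolding abs_le_square_iff[symmetric] by auto
  then have "(\<integral>x. (max (a x - 1) 0)\<^sup>2 \<partial>M) \<le> (\<integral>x. (a x)\<^sup>2 \<partial>M)"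
    using m assms by (intro integral_mono) (auto simp: memLp2_iff)
  then have "e * (\<integral>x. (max (a x - 1) 0)\<^sup>2 \<partial>M) \<le> e * (\<integral>x. (a x)\<^sup>2 \<partial>M)" using assms(3) by simp
  then show ?thesis
    using integral_excess_sq_le[OF assms(1,2)] memLp2_mult_le[OF m(2,1) assms(3)]
    by (simp add: distrib_right)
qed

lemma Lpnorm_tendsto_0_iff:
  assumes "0 < p"
  shows "((\<lambda>i. Lpnorm M p (u i)) \<longlongrightarrow> 0) F \<longleftrightarrow> ((\<lambda>i. \<integral>x. \<bar>u i x\<bar> powr p \<partial>M) \<longlongrightarrow> 0) F"
proof
  assume "((\<lambda>i. Lpnorm M p (u i)) \<longlongrightarrow> 0) F"
  then have "((\<lambda>i. Lpnorm M p (u i) powr p) \<longlongrightarrow> 0 powr p) F"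
    using assms by (intro tendsto_powr2 tendsto_const) (auto simp: Lpnorm_def)
  then show "((\<lambda>i. \<integral>x. \<bar>u i x\<bar> powr p \<partial>M) \<longlongrightarrow> 0) F"
    using assms by (simp add: Lpnorm_def powr_powr)
next
  assume "((\<lambda>i. \<integral>x. \<bar>u i x\<bar> powr p \<partial>M) \<longlongrightarrow> 0) F"
  then have "((\<lambda>i. (\<integral>x. \<bar>u i x\<bar> powr p \<partial>M) powr (1 / p)) \<longlongrightarrow> 0 powr (1 / p)) F"
    using assms by (intro tendsto_powr2 tendsto_const) auto
  then show "((\<lambda>i. Lpnorm M p (u i)) \<longlongrightarrow> 0) F"
    by (simp add: Lpnorm_def)
qed

text \<open>A substitute for Hoelder's inequality when \<open>w\<close> is integrable and bounded.\<close>

lemma memLp_mult_bounded_L1: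
  assumes p: "1 \<le> p" and r: "memLp M p r" and w: "integrable M w" "AE x in M. \<bar>w x\<bar> \<le> K"
  shows "integrable M (\<lambda>x. r x * w x)"
    and "0 < e \<Longrightarrow> \<bar>\<integral>x. r x * w x \<partial>M\<bar> \<le> e * (\<integral>x. \<bar>w x\<bar> \<partial>M) + K * e powr (1 - p) * (\<integral>x. \<bar>r x\<bar> powr p \<partial>M)"
proof -
  \<comment> \<open>Values up to \<open>e\<close> are covered by the first summand. For
    \<open>a > e\<close> the exponent \<open>1 - p\<close> is nonpositive, so
    \<open>a powr (1 - p) <= e powr (1 - p)\<close>.\<close>
  have *: "a \<le> e + e powr (1 - p) * a powr p" if "0 < e" "0 \<le> a" for a e :: real
  proof (cases "a \<le> e")
    case False
    have "a = a powr (1 - p) * a powr p" using that False by (simp flip: powr_add)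
    also have "\<dots> \<le> e powr (1 - p) * a powr p"
      using that False p by (intro mult_right_mono powr_mono2') auto
    finally show ?thesis using that by simp
  qed (simp add: add_increasing2)
  have bound: "AE x in M. \<bar>r x * w x\<bar> \<le> e * \<bar>w x\<bar> + K * e powr (1 - p) * \<bar>r x\<bar> powr p" if e: "0 < e" for e
    using w(2)
  proof eventually_elim
    case (elim x)
    have "\<bar>r x\<bar> * \<bar>w x\<bar> \<le> (e + e powr (1 - p) * \<bar>r x\<bar> powr p) * \<bar>w x\<bar>"
      using *[OF e, of "\<bar>r x\<bar>"] by (intro mult_right_mono) auto
    also have "\<dots> = e * \<bar>w x\<bar> + (e powr (1 - p) * \<bar>r x\<bar> powr p) * \<bar>w x\<bar>" by (simp add: algebra_simps)
    also have "\<dots> \<le> e * \<bar>w x\<bar> + (e powr (1 - p) * \<bar>r x\<bar> powr p) * K"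
      using elim by (intro add_left_mono mult_left_mono) auto
    finally show ?case by (simp add: abs_mult mult_ac)
  qed
  have int: "integrable M (\<lambda>x. e * \<bar>w x\<bar> + K * e powr (1 - p) * \<bar>r x\<bar> powr p)" for e
    using w r by (simp add: memLp_def)
  show int': "integrable M (\<lambda>x. r x * w x)"
  proof (rule Bochner_Integration.integrable_bound[OF int[of 1]])
    show "AE x in M. norm (r x * w x) \<le> norm (1 * \<bar>w x\<bar> + K * 1 powr (1 - p) * \<bar>r x\<bar> powr p)"
      using bound[OF zero_less_one] by eventually_elim simp
  qed (use w r in \<open>auto simp: memLp_def\<close>)
  assume e: "0 < e"
  have "\<bar>\<integral>x. r x * w x \<partial>M\<bar> \<le> (\<integral>x. \<bar>r x * w x\<bar> \<partial>M)" by (rule integral_abs_bound)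
  also have "\<dots> \<le> (\<integral>x. e * \<bar>w x\<bar> + K * e powr (1 - p) * \<bar>r x\<bar> powr p \<partial>M)"
    by (rule integral_mono_AE[OF integrable_abs[OF int'] int bound[OF e]])
  also have "\<dots> = e * (\<integral>x. \<bar>w x\<bar> \<partial>M) + K * e powr (1 - p) * (\<integral>x. \<bar>r x\<bar> powr p \<partial>M)"
    using w r by (simp add: memLp_def)
  finally show "\<bar>\<integral>x. r x * w x \<partial>M\<bar> \<le> e * (\<integral>x. \<bar>w x\<bar> \<partial>M) + K * e powr (1 - p) * (\<integral>x. \<bar>r x\<bar> powr p \<partial>M)" .
qed

lemma bounded_L1_imp_memLp2:
  assumes w: "integrable M w" "AE x in M. \<bar>w x\<bar> \<le> K"
  shows "memLp M 2 w"
  unfolding memLp2_iff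
proof
  show "integrable M (\<lambda>x. (w x)\<^sup>2)"
    using memLp_mult_bounded_L1(1)[of 1 M w w K] w by (simp add: memLp_def power2_eq_square)
qed (use w in auto)

lemma tendsto_integral_mult_Lp:
  assumes p: "1 \<le> p" and r: "\<And>i. memLp M p (r i)" and w: "integrable M w" "AE x in M. \<bar>w x\<bar> \<le> K"
    and lim: "((\<lambda>i. \<integral>x. \<bar>r i x\<bar> powr p \<partial>M) \<longlongrightarrow> 0) F"
  shows "((\<lambda>i. \<integral>x. r i x * w x \<partial>M) \<longlongrightarrow> 0) F"
proof (rule tendstoI)
  fix \<delta> :: real assume "0 < \<delta>"
  define W where "W = (\<integral>x. \<bar>w x\<bar> \<partial>M)"
  have W: "0 \<le> W" by (simp add: W_def)
  define e where "e = \<delta> / (2 * (W + 1))"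
  have e: "0 < e" "e * W \<le> \<delta> / 2"
    using W \<open>0 < \<delta>\<close> by (auto simp: e_def field_simps)
  have "((\<lambda>i. K * e powr (1 - p) * (\<integral>x. \<bar>r i x\<bar> powr p \<partial>M)) \<longlongrightarrow> K * e powr (1 - p) * 0) F"
    by (intro tendsto_intros lim)
  then have "\<forall>\<^sub>F i in F. K * e powr (1 - p) * (\<integral>x. \<bar>r i x\<bar> powr p \<partial>M) < \<delta> / 2"
    using \<open>0 < \<delta>\<close> by (intro order_tendstoD(2)) auto
  then show "\<forall>\<^sub>F i in F. dist (\<integral>x. r i x * w x \<partial>M) 0 < \<delta>"
  proof eventually_elim
    case (elim i)
    then show ?case
      using memLp_mult_bounded_L1(2)[OF p r w e(1), of i] e(2) unfolding W_def by simp
  qed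
qed

text \<open>Values of \<open>f\<close> are cut off both near zero and near infinity: the first makes
  the support have finite measure, the second makes the function bounded. Dominated convergence with
  majorant \<open>\<bar>f x\<bar> powr p\<close> gives the limit.\<close>

lemma Lp_approx_by_L2:
  assumes p: "1 \<le> p" and f: "memLp M p f"
  obtains u :: "nat \<Rightarrow> 'a \<Rightarrow> real" where "\<And>n. memLp M p (u n)" "\<And>n. memLp M 2 (u n)"
    "(\<lambda>n. \<integral>x. \<bar>u n x - f x\<bar> powr p \<partial>M) \<longlonglongrightarrow> 0"
proof
  define P where "P n x \<longleftrightarrow> inverse (real (Suc n)) < \<bar>f x\<bar> \<and> \<bar>f x\<bar> \<le> real n" for n x
  define u where "u n x = (if P n x then f x else 0)" for n x
  have [measurable]: "f \<in> borel_measurable M" using f by (simp add: memLp_def)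
  have um [measurable]: "u n \<in> borel_measurable M" for n
    unfolding u_def P_def by measurable
  show "memLp M p (u n)" for n
    by (rule memLp_bound[OF f um]) (use p in \<open>auto simp: u_def\<close>)
  show "memLp M 2 (u n)" for n
    unfolding memLp2_iff
  proof
    show "integrable M (\<lambda>x. (u n x)\<^sup>2)"
    proof (rule Bochner_Integration.integrable_bound)
      show "integrable M (\<lambda>x. (real n)\<^sup>2 * real (Suc n) powr p * \<bar>f x\<bar> powr p)"
        using f by (simp add: memLp_def)
      \<comment> \<open>On the support of \<open>u n\<close> the factor
        \<open>(real (Suc n) * \<bar>f x\<bar>) powr p\<close> is at least 1, so it may be inserted
        after bounding \<open>f\<close> by \<open>n\<close>.\<close>
      have "(u n x)\<^sup>2 \<le> (real n)\<^sup>2 * real (Suc n) powr p * \<bar>f x\<bar> powr p" for x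
      proof (cases "P n x")
        case True
        have "1 \<le> real (Suc n) * \<bar>f x\<bar>" using True by (simp add: P_def field_simps)
        then have "1 \<le> (real (Suc n) * \<bar>f x\<bar>) powr p" using p by (intro ge_one_powr_ge_zero) auto
        then have "1 \<le> real (Suc n) powr p * \<bar>f x\<bar> powr p" by (simp add: powr_mult)
        moreover have "(f x)\<^sup>2 \<le> (real n)\<^sup>2" using True by (simp add: P_def flip: abs_le_square_iff)
        ultimately have "(f x)\<^sup>2 * 1 \<le> (real n)\<^sup>2 * (real (Suc n) powr p * \<bar>f x\<bar> powr p)"
          by (intro mult_mono) auto
        then show ?thesis using True by (simp add: u_def mult.assoc)
      qed (simp add: u_def)
      then show "AE x in M. norm ((u n x)\<^sup>2) \<le> norm ((real n)\<^sup>2 * real (Suc n) powr p * \<bar>f x\<bar> powr p)"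
        by simp
    qed simp
  qed (rule um)
  have "(\<lambda>n. \<integral>x. \<bar>u n x - f x\<bar> powr p \<partial>M) \<longlonglongrightarrow> (\<integral>x. 0 \<partial>M)"
  proof (rule integral_dominated_convergence)
    show "integrable M (\<lambda>x. \<bar>f x\<bar> powr p)" using f by (simp add: memLp_def)
    show "AE x in M. norm (\<bar>u n x - f x\<bar> powr p) \<le> \<bar>f x\<bar> powr p" for n
      by (auto simp: u_def)
    have "(\<lambda>n. \<bar>u n x - f x\<bar> powr p) \<longlonglongrightarrow> 0" for x
    proof (cases "f x = 0")
      case False
      have "\<forall>\<^sub>F n in sequentially. inverse (real (Suc n)) < \<bar>f x\<bar>"
        using False by (intro order_tendstoD(2)[OF LIMSEQ_inverse_real_of_nat]) simp
      moreover have "\<forall>\<^sub>F n in sequentially. \<bar>f x\<bar> \<le> real n"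
        by (rule eventually_ge_at_top[THEN eventually_mono, of "nat \<lceil>\<bar>f x\<bar>\<rceil>"]) linarith
      ultimately have "\<forall>\<^sub>F n in sequentially. 0 = \<bar>u n x - f x\<bar> powr p"
        by eventually_elim (simp add: u_def P_def)
      then show ?thesis by (rule Lim_transform_eventually[OF tendsto_const])
    next
      case True
      then have "u n x = 0" for n by (simp add: u_def)
      with True show ?thesis by simp
    qed
    then show "AE x in M. (\<lambda>n. \<bar>u n x - f x\<bar> powr p) \<longlonglongrightarrow> 0" by simp
  qed auto
  then show "(\<lambda>n. \<integral>x. \<bar>u n x - f x\<bar> powr p \<partial>M) \<longlonglongrightarrow> 0" by simp
qed

section \<open>The sub-Markov property\<close>

locale L2_semigroup =
  fixes M :: "'a measure" and T :: "real \<Rightarrow> ('a \<Rightarrow> real) \<Rightarrow> ('a \<Rightarrow> real)"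
  assumes semigroup: "sym_C0_contraction_sg M T"
begin

lemmas semigroup_props = semigroup[unfolded sym_C0_contraction_sg_def]

lemma memLp2_T: "0 \<le> t \<Longrightarrow> memLp M 2 f \<Longrightarrow> memLp M 2 (T t f)"
  using semigroup_props[THEN conjunct1] by blast

lemma T_cong:
  "0 \<le> t \<Longrightarrow> memLp M 2 f \<Longrightarrow> memLp M 2 g \<Longrightarrow> AE x in M. f x = g x \<Longrightarrow> AE x in M. T t f x = T t g x"
  using semigroup_props[THEN conjunct2, THEN conjunct1] by blast

lemma T_lincomb:
  "0 \<le> t \<Longrightarrow> memLp M 2 f \<Longrightarrow> memLp M 2 g \<Longrightarrow>
    AE x in M. T t (\<lambda>y. a * f y + b * g y) x = a * T t f x + b * T t g x"
  using semigroup_props[THEN conjunct2, THEN conjunct2, THEN conjunct1] by simp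

lemma T_0: "memLp M 2 f \<Longrightarrow> AE x in M. T 0 f x = f x"
  using semigroup_props by simp

lemma T_add:
  "0 \<le> s \<Longrightarrow> 0 \<le> t \<Longrightarrow> memLp M 2 f \<Longrightarrow> AE x in M. T (s + t) f x = T s (T t f) x"
  using semigroup_props by simp

lemma T_symmetric:
  "0 \<le> t \<Longrightarrow> memLp M 2 f \<Longrightarrow> memLp M 2 g \<Longrightarrow>
    (\<integral>x. T t f x * g x \<partial>M) = (\<integral>x. f x * T t g x \<partial>M)"
  using semigroup_props by simp

lemma T_measurable [measurable]: "0 \<le> t \<Longrightarrow> memLp M 2 f \<Longrightarrow> T t f \<in> borel_measurable M"
  by (rule memLp_measurable[OF memLp2_T])

lemma T_contraction:
  "0 \<le> t \<Longrightarrow> memLp M 2 f \<Longrightarrow> (\<integral>x. (T t f x)\<^sup>2 \<partial>M) \<le> (\<integral>x. (f x)\<^sup>2 \<partial>M)"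
  using semigroup_props by (simp add: Lpnorm_2)

lemma T_continuous_0:
  assumes "memLp M 2 f"
  shows "((\<lambda>t. \<integral>x. (T t f x - f x)\<^sup>2 \<partial>M) \<longlongrightarrow> 0) (at_right 0)"
proof -
  have "((\<lambda>t. (Lpnorm M 2 (\<lambda>x. T t f x - f x))\<^sup>2) \<longlongrightarrow> 0\<^sup>2) (at_right 0)"
    using semigroup_props assms by (intro tendsto_power) simp
  then show ?thesis by (simp add: Lpnorm_2)
qed

lemma T_diff:
  assumes "0 \<le> t" "memLp M 2 f" "memLp M 2 g"
  shows "AE x in M. T t (\<lambda>y. f y - g y) x = T t f x - T t g x"
  using T_lincomb[OF assms, of 1 "-1"] by simp

lemma T_scale:
  assumes "0 \<le> t" "memLp M 2 f"
  shows "AE x in M. T t (\<lambda>y. c * f y) x = c * T t f x"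
  using T_lincomb[OF assms assms(2), of c 0] by simp

text \<open>Symmetry moves one operator across and the semigroup law merges the two. The pairing
  thus depends on \<open>s + t\<close> only, and for \<open>f = g\<close> the case
  \<open>s = t\<close> is a squared norm.\<close>

lemma integral_T_T:
  assumes "0 \<le> s" "0 \<le> t" "memLp M 2 f" "memLp M 2 g"
  shows "(\<integral>x. T s f x * T t g x \<partial>M) = (\<integral>x. T (s + t) f x * g x \<partial>M)"
proof -
  have "(\<integral>x. T s f x * T t g x \<partial>M) = (\<integral>x. T t (T s f) x * g x \<partial>M)"
    using assms by (simp add: T_symmetric memLp2_T)
  also have "\<dots> = (\<integral>x. T (s + t) f x * g x \<partial>M)"
    using T_add[of t s f] assms memLp2_T[of s f]
    by (intro integral_cong_AE borel_measurable_times T_measurable memLp_measurable[of M 2])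
      (auto simp: add.commute)
  finally show ?thesis .
qed

text \<open>The left difference is \<open>T s\<close> applied to \<open>T (t - s) f - f\<close>, and
  \<open>T s\<close> is a contraction. This reduces continuity from both sides at any time to
  continuity at time 0.\<close>

lemma integral_T_diff_sq_le:
  assumes "0 \<le> s" "s \<le> t" "memLp M 2 f"
  shows "(\<integral>x. (T t f x - T s f x)\<^sup>2 \<partial>M) \<le> (\<integral>x. (T (t - s) f x - f x)\<^sup>2 \<partial>M)"
proof -
  have m: "memLp M 2 (T (t - s) f)" using assms by (intro memLp2_T) auto
  have "AE x in M. T (s + (t - s)) f x = T s (T (t - s) f) x"
    using assms by (intro T_add) auto
  moreover have "AE x in M. T s (\<lambda>y. T (t - s) f y - f y) x = T s (T (t - s) f) x - T s f x"
    using assms m by (intro T_diff) auto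
  ultimately have "AE x in M. (T t f x - T s f x)\<^sup>2 = (T s (\<lambda>y. T (t - s) f y - f y) x)\<^sup>2"
    by eventually_elim simp
  then have "(\<integral>x. (T t f x - T s f x)\<^sup>2 \<partial>M) = (\<integral>x. (T s (\<lambda>y. T (t - s) f y - f y) x)\<^sup>2 \<partial>M)"
    using assms m
    by (intro integral_cong_AE borel_measurable_power borel_measurable_diff T_measurable memLp2_diff) auto
  also have "\<dots> \<le> (\<integral>x. (T (t - s) f x - f x)\<^sup>2 \<partial>M)"
    using assms m by (intro T_contraction memLp2_diff) auto
  finally show ?thesis .
qed

lemma T_continuous:
  assumes "memLp M 2 f" "0 \<le> s"
  shows "((\<lambda>t. \<integral>x. (T t f x - T s f x)\<^sup>2 \<partial>M) \<longlongrightarrow> 0) (at s within {0..})"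
proof (rule tendstoI)
  fix e :: real assume "0 < e"
  then have "\<forall>\<^sub>F t in at_right 0. (\<integral>x. (T t f x - f x)\<^sup>2 \<partial>M) < e"
    using order_tendstoD(2)[OF T_continuous_0[OF assms(1)]] by auto
  then obtain d where d: "d > 0" "\<And>h. 0 < h \<Longrightarrow> h < d \<Longrightarrow> (\<integral>x. (T h f x - f x)\<^sup>2 \<partial>M) < e"
    by (auto simp: eventually_at_right_field)
  have "(\<integral>x. (T t f x - T s f x)\<^sup>2 \<partial>M) < e" if "0 \<le> t" "t \<noteq> s" "\<bar>t - s\<bar> < d" for t
  proof (cases "s < t")
    case True
    then show ?thesis using integral_T_diff_sq_le[of s t f] d(2)[of "t - s"] that assms by auto
  next
    case False
    have "(\<integral>x. (T t f x - T s f x)\<^sup>2 \<partial>M) = (\<integral>x. (T s f x - T t f x)\<^sup>2 \<partial>M)"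
      by (simp add: power2_commute)
    then show ?thesis using False integral_T_diff_sq_le[of t s f] d(2)[of "s - t"] that assms by auto
  qed
  then show "\<forall>\<^sub>F t in at s within {0..}. dist (\<integral>x. (T t f x - T s f x)\<^sup>2 \<partial>M) 0 < e"
    using d(1) by (auto simp: eventually_at dist_real_def)
qed

lemma continuous_on_integral_T:
  assumes f: "memLp M 2 f"
  shows "continuous_on {0..} (\<lambda>t. \<integral>x. T t f x * f x \<partial>M)"
  unfolding continuous_on_def
proof
  fix s :: real assume s: "s \<in> {0..}"
  have ev: "\<forall>\<^sub>F t in at s within {0..}. t \<in> {0..}"
    by (auto simp: eventually_at intro!: exI[of _ 1])
  have "((\<lambda>t. \<integral>x. (T t f x - T s f x) * f x \<partial>M) \<longlongrightarrow> 0) (at s within {0..})"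
    using s f by (intro tendsto_integral_mult_L2 T_continuous eventually_mono[OF ev] memLp2_diff memLp2_T) auto
  moreover have "\<forall>\<^sub>F t in at s within {0..}. (\<integral>x. (T t f x - T s f x) * f x \<partial>M) =
      (\<integral>x. T t f x * f x \<partial>M) - (\<integral>x. T s f x * f x \<partial>M)"
    by (rule eventually_mono[OF ev])
      (use s f in \<open>auto simp: left_diff_distrib memLp2_mult_integrable memLp2_T\<close>)
  ultimately have "((\<lambda>t. (\<integral>x. T t f x * f x \<partial>M) - (\<integral>x. T s f x * f x \<partial>M)) \<longlongrightarrow> 0) (at s within {0..})"
    by (rule Lim_transform_eventually)
  then show "((\<lambda>t. \<integral>x. T t f x * f x \<partial>M) \<longlongrightarrow> (\<integral>x. T s f x * f x \<partial>M)) (at s within {0..})"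
    by (rule Lim_null[THEN iffD2])
qed

text \<open>With \<open>a = T (s / 2) f\<close> and \<open>b = T (t / 2) f\<close>, the midpoint
  inequality is the nonnegativity of the squared norm of \<open>a - b\<close>. No spectral
  representation is involved.\<close>

lemma convex_on_integral_T:
  assumes f: "memLp M 2 f"
  shows "convex_on {0..} (\<lambda>t. \<integral>x. T t f x * f x \<partial>M)"
proof (rule midpoint_convex_imp_convex_on[OF continuous_on_integral_T[OF f]])
  fix s t :: real assume st: "0 \<le> s" "0 \<le> t"
  define a b where "a = T (s / 2) f" and "b = T (t / 2) f"
  have m: "memLp M 2 a" "memLp M 2 b" using st f by (auto simp: a_def b_def memLp2_T)
  have "0 \<le> (\<integral>x. (a x - b x)\<^sup>2 \<partial>M)" by simp
  also have "\<dots> = (\<integral>x. a x * a x + b x * b x - 2 * (a x * b x) \<partial>M)"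
    by (simp add: power2_eq_square algebra_simps)
  also have "\<dots> = (\<integral>x. a x * a x \<partial>M) + (\<integral>x. b x * b x \<partial>M) - 2 * (\<integral>x. a x * b x \<partial>M)"
    using m by (simp add: memLp2_mult_integrable)
  finally show "2 * (\<integral>x. T ((s + t) / 2) f x * f x \<partial>M) \<le>
      (\<integral>x. T s f x * f x \<partial>M) + (\<integral>x. T t f x * f x \<partial>M)"
    using st f by (simp add: a_def b_def integral_T_T add_divide_distrib)
qed

end

section \<open>Recovering the form from the semigroup, and the Markov bound at level 1\<close>

locale dirichlet_semigroup = L2_semigroup M T + sigma_finite_measure M
  for M :: "'a measure" and T +
  fixes D :: "('a \<Rightarrow> real) set" and B :: "('a \<Rightarrow> real) \<Rightarrow> ('a \<Rightarrow> real) \<Rightarrow> real"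
  assumes form: "dirichlet_form M D B"
    and assoc: "associated_semigroup M D B T"
begin

lemmas form_props = form[unfolded dirichlet_form_def]

lemma D_memLp2: "f \<in> D \<Longrightarrow> memLp M 2 f"
  using form_props[THEN conjunct1] by blast

lemma D_lincomb: "f \<in> D \<Longrightarrow> g \<in> D \<Longrightarrow> (\<lambda>x. a * f x + b * g x) \<in> D"
  using form_props[THEN conjunct2, THEN conjunct2, THEN conjunct1] by blast

lemma B_sym: "f \<in> D \<Longrightarrow> g \<in> D \<Longrightarrow> B f g = B g f"
  using form_props[THEN conjunct2, THEN conjunct2, THEN conjunct2, THEN conjunct2, THEN conjunct1] by blast

lemma B_lincomb_left:
  "f \<in> D \<Longrightarrow> g \<in> D \<Longrightarrow> h \<in> D \<Longrightarrow> B (\<lambda>x. a * f x + b * g x) h = a * B f h + b * B g h"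
  using form_props[THEN conjunct2, THEN conjunct2, THEN conjunct2, THEN conjunct2, THEN conjunct2, THEN conjunct1] by blast

lemma B_lincomb_right:
  "f \<in> D \<Longrightarrow> g \<in> D \<Longrightarrow> h \<in> D \<Longrightarrow> B h (\<lambda>x. a * f x + b * g x) = a * B h f + b * B h g"
  by (simp add: B_sym[of h] D_lincomb B_lincomb_left)

lemma B_nonneg: "f \<in> D \<Longrightarrow> 0 \<le> B f f"
  using form_props[THEN conjunct2, THEN conjunct2, THEN conjunct2, THEN conjunct2, THEN conjunct2, THEN conjunct2, THEN conjunct1] by blast

lemma D_contraction: "normal_contraction C \<Longrightarrow> f \<in> D \<Longrightarrow> C \<circ> f \<in> D"
  using form_props[THEN conjunct2, THEN conjunct2, THEN conjunct2, THEN conjunct2, THEN conjunct2, THEN conjunct2, THEN conjunct2, THEN conjunct2, THEN conjunct2] by blast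

lemma B_contraction: "normal_contraction C \<Longrightarrow> f \<in> D \<Longrightarrow> B (C \<circ> f) (C \<circ> f) \<le> B f f"
  using form_props[THEN conjunct2, THEN conjunct2, THEN conjunct2, THEN conjunct2, THEN conjunct2, THEN conjunct2, THEN conjunct2, THEN conjunct2, THEN conjunct2] by blast

text \<open>The bounded form of the operator \<open>I - T h\<close>. Its quotient by
  \<open>h\<close> is the usual approximation of the Dirichlet form; the division is left out to
  keep the algebraic identities free of it.\<close>

definition approx_form :: "real \<Rightarrow> ('a \<Rightarrow> real) \<Rightarrow> ('a \<Rightarrow> real) \<Rightarrow> real" where
  "approx_form h f g = (\<integral>x. (f x - T h f x) * g x \<partial>M)"

lemma approx_form_eq:
  assumes "0 \<le> h" "memLp M 2 f" "memLp M 2 g"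
  shows "approx_form h f g = (\<integral>x. f x * g x \<partial>M) - (\<integral>x. T h f x * g x \<partial>M)"
  using assms by (simp add: approx_form_def left_diff_distrib memLp2_mult_integrable memLp2_T)

lemma approx_form_sym:
  assumes "0 \<le> h" "memLp M 2 f" "memLp M 2 g"
  shows "approx_form h f g = approx_form h g f"
  using assms T_symmetric[OF assms] by (simp add: approx_form_eq mult.commute)

lemma approx_form_lincomb_right:
  assumes "0 \<le> h" "memLp M 2 f" "memLp M 2 g" "memLp M 2 k"
  shows "approx_form h k (\<lambda>x. a * f x + b * g x) = a * approx_form h k f + b * approx_form h k g"
proof -
  have m: "memLp M 2 (\<lambda>x. k x - T h k x)" using assms by (intro memLp2_diff memLp2_T)
  have "approx_form h k (\<lambda>x. a * f x + b * g x) =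
      (\<integral>x. a * ((k x - T h k x) * f x) + b * ((k x - T h k x) * g x) \<partial>M)"
    unfolding approx_form_def by (rule Bochner_Integration.integral_cong) (auto simp: algebra_simps)
  also have "\<dots> = a * approx_form h k f + b * approx_form h k g"
    using assms memLp2_mult_integrable[OF m] by (simp add: approx_form_def)
  finally show ?thesis .
qed

lemma approx_form_lincomb_left:
  assumes "0 \<le> h" "memLp M 2 f" "memLp M 2 g" "memLp M 2 k"
  shows "approx_form h (\<lambda>x. a * f x + b * g x) k = a * approx_form h f k + b * approx_form h g k"
  using assms by (simp add: approx_form_sym[of h _ k] approx_form_lincomb_right memLp2_lincomb)

lemma D_iff:
  "memLp M 2 f \<Longrightarrow> f \<in> D \<longleftrightarrow> (\<exists>c. ((\<lambda>h. approx_form h f f / h) \<longlongrightarrow> c) (at_right 0))"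
  using assoc unfolding associated_semigroup_def approx_form_def by simp

lemma approx_form_tendsto_quadratic:
  "f \<in> D \<Longrightarrow> ((\<lambda>h. approx_form h f f / h) \<longlongrightarrow> B f f) (at_right 0)"
  using assoc unfolding associated_semigroup_def approx_form_def by simp

text \<open>Polarization: association of form and semigroup is given for the quadratic form
  only.\<close>

lemma approx_form_tendsto:
  assumes f: "f \<in> D" and g: "g \<in> D"
  shows "((\<lambda>h. approx_form h f g / h) \<longlongrightarrow> B f g) (at_right 0)"
proof -
  \<comment> \<open>The explicit coefficients make \<open>u\<close> and \<open>v\<close> syntactic
    instances of the linear combination rules for \<open>D\<close>, \<open>B\<close> and
    \<open>approx_form\<close>.\<close>
  define u v where "u = (\<lambda>x. 1 * f x + 1 * g x)" and "v = (\<lambda>x. 1 * f x + (-1) * g x)"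
  note m = D_memLp2[OF f] D_memLp2[OF g]
  have uv: "u \<in> D" "v \<in> D" using f g unfolding u_def v_def by (blast intro: D_lincomb)+
  have "((\<lambda>h. (approx_form h u u / h - approx_form h v v / h) / 4) \<longlongrightarrow> (B u u - B v v) / 4) (at_right 0)"
    using uv by (intro tendsto_intros approx_form_tendsto_quadratic) auto
  moreover have "B u u - B v v = 4 * B f g"
    using f g unfolding u_def v_def
    by (simp only: B_lincomb_left B_lincomb_right D_lincomb B_sym[of g f]) simp
  moreover have "\<forall>\<^sub>F h in at_right 0. (approx_form h u u / h - approx_form h v v / h) / 4 = approx_form h f g / h"
  proof (rule eventually_mono[OF eventually_at_right_less])
    fix h :: real assume h: "0 < h"
    then have "approx_form h u u - approx_form h v v = 4 * approx_form h f g"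
      using m approx_form_sym[of h g f] unfolding u_def v_def
      by (simp only: approx_form_lincomb_left approx_form_lincomb_right memLp2_lincomb less_imp_le) simp
    then show "(approx_form h u u / h - approx_form h v v / h) / 4 = approx_form h f g / h"
      by (simp add: diff_divide_distrib[symmetric])
  qed
  ultimately show ?thesis using Lim_transform_eventually by fastforce
qed

text \<open>With \<open>F t\<close> the pairing of \<open>T t f\<close> and \<open>f\<close>, the
  approximating form at \<open>T s f\<close> is \<open>F (2 * s) - F (2 * s + h)\<close>. Its
  quotient by \<open>h\<close> tends to minus the right derivative of the convex \<open>F\<close> at
  the positive time \<open>2 * s\<close>, and \<open>D\<close> consists of the functions for which
  such a limit exists.\<close>

lemma T_in_D:
  assumes s: "0 < s" and f: "memLp M 2 f"
  shows "T s f \<in> D"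
proof -
  define F where "F t = (\<integral>x. T t f x * f x \<partial>M)" for t
  have m: "memLp M 2 (T s f)" using s f by (intro memLp2_T) auto
  obtain c where c: "((\<lambda>h. (F (2 * s + h) - F (2 * s)) / h) \<longlongrightarrow> c) (at_right 0)"
    using convex_on_right_derivative_exists[OF convex_on_integral_T[OF f], of "2 * s"] s
    unfolding F_def by auto
  have "((\<lambda>h. - ((F (2 * s + h) - F (2 * s)) / h)) \<longlongrightarrow> - c) (at_right 0)"
    by (rule tendsto_minus[OF c])
  moreover have "\<forall>\<^sub>F h in at_right 0. - ((F (2 * s + h) - F (2 * s)) / h) = approx_form h (T s f) (T s f) / h"
  proof (rule eventually_mono[OF eventually_at_right_less])
    fix h :: real assume h: "0 < h"
    have "(\<integral>x. T h (T s f) x * T s f x \<partial>M) = (\<integral>x. T (s + h) (T s f) x * f x \<partial>M)"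
      using h s f m by (subst integral_T_T) (auto simp: add.commute)
    also have "\<dots> = (\<integral>x. T (s + h) f x * T s f x \<partial>M)"
      using h s f m T_symmetric[of "s + h" "T s f" f] by (simp add: mult.commute)
    also have "\<dots> = F (2 * s + h)"
      using h s f by (simp add: integral_T_T F_def add_ac)
    finally have "approx_form h (T s f) (T s f) = F (2 * s) - F (2 * s + h)"
      using h s f m by (simp add: approx_form_eq integral_T_T F_def)
    then show "- ((F (2 * s + h) - F (2 * s)) / h) = approx_form h (T s f) (T s f) / h"
      by (simp add: minus_divide_left)
  qed
  ultimately have "((\<lambda>h. approx_form h (T s f) (T s f) / h) \<longlongrightarrow> - c) (at_right 0)"
    by (rule Lim_transform_eventually)
  then show ?thesis using D_iff[OF m] by blast
qed

text \<open>Writing \<open>a h\<close> for \<open>approx_form h f f\<close>, the squared norm of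
  \<open>T h f - f\<close> is \<open>2 * a h - a (2 * h)\<close>. Both \<open>a h / h\<close> and
  \<open>a (2 * h) / (2 * h)\<close> tend to \<open>B f f\<close>, so the quotient tends to
  \<open>2 * B f f - 2 * B f f\<close>.\<close>

lemma T_diff_sq_little_o:
  assumes f: "f \<in> D"
  shows "((\<lambda>h. (\<integral>x. (T h f x - f x)\<^sup>2 \<partial>M) / h) \<longlongrightarrow> 0) (at_right 0)"
proof -
  note m = D_memLp2[OF f]
  have 2: "filterlim (\<lambda>h::real. 2 * h) (at_right 0) (at_right 0)"
    by (auto simp: filterlim_at intro!: tendsto_eq_intros eventually_mono[OF eventually_at_right_less])
  have "((\<lambda>h. 2 * (approx_form h f f / h) - 2 * (approx_form (2 * h) f f / (2 * h))) \<longlongrightarrow>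
      2 * B f f - 2 * B f f) (at_right 0)"
    using f by (intro tendsto_diff tendsto_mult tendsto_const approx_form_tendsto
        filterlim_compose[OF approx_form_tendsto 2]) auto
  moreover have "\<forall>\<^sub>F h in at_right 0. 2 * (approx_form h f f / h) - 2 * (approx_form (2 * h) f f / (2 * h)) =
      (\<integral>x. (T h f x - f x)\<^sup>2 \<partial>M) / h"
  proof (rule eventually_mono[OF eventually_at_right_less])
    fix h :: real assume h: "0 < h"
    have mT: "memLp M 2 (T h f)" using h m by (intro memLp2_T) auto
    have "(\<integral>x. (T h f x - f x)\<^sup>2 \<partial>M) = (\<integral>x. T h f x * T h f x + f x * f x - 2 * (T h f x * f x) \<partial>M)"
      by (simp add: power2_eq_square algebra_simps)
    also have "\<dots> = (\<integral>x. T h f x * T h f x \<partial>M) + (\<integral>x. f x * f x \<partial>M) - 2 * (\<integral>x. T h f x * f x \<partial>M)"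
      using m mT by (simp add: memLp2_mult_integrable)
    also have "\<dots> = 2 * approx_form h f f - approx_form (2 * h) f f"
      using h m by (simp add: approx_form_eq integral_T_T)
    finally show "2 * (approx_form h f f / h) - 2 * (approx_form (2 * h) f f / (2 * h)) =
      (\<integral>x. (T h f x - f x)\<^sup>2 \<partial>M) / h"
      by (simp add: diff_divide_distrib)
  qed
  ultimately show ?thesis using Lim_transform_eventually by fastforce
qed

text \<open>With \<open>c = min f 1\<close>, truncating \<open>c + e * w\<close> at height 1 gives back \<open>c\<close> for every \<open>e > 0\<close>, so
  the Markov property makes \<open>e \<mapsto> B (c + e * w) (c + e * w)\<close> minimal at 0 and \<open>B c w \<ge> 0\<close>.\<close>

lemma B_excess_nonneg:
  assumes f: "f \<in> D"
  defines "w \<equiv> \<lambda>x. max (f x - 1) 0"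
  shows "w \<in> D" "0 \<le> B f w"
proof -
  define C where "C = (\<lambda>y::real. min y 1)"
  define c where "c = C \<circ> f"
  have C: "normal_contraction C" by (auto simp: normal_contraction_def C_def min_def abs_if)
  have c: "c \<in> D" unfolding c_def by (rule D_contraction[OF C f])
  have w: "w = (\<lambda>x. 1 * f x + (-1) * c x)"
    by (auto simp: w_def c_def C_def fun_eq_iff)
  show wD: "w \<in> D" unfolding w by (intro D_lincomb f c)
  have fcw: "f = (\<lambda>x. 1 * c x + 1 * w x)" by (auto simp: w)
  have "0 \<le> 2 * B c w + e * B w w" if e: "0 < e" for e
  proof -
    define v where "v = (\<lambda>x. 1 * c x + e * w x)"
    have v: "v \<in> D" unfolding v_def by (intro D_lincomb c wD)
    have "C (v x) = c x" for x
      using e by (auto simp: v_def w_def c_def C_def min_def max_def mult_le_0_iff)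
    then have "C \<circ> v = c" by auto
    then have "B c c \<le> B v v" using B_contraction[OF C v] by simp
    also have "\<dots> = B c c + e * (2 * B c w + e * B w w)"
      using c wD unfolding v_def
      by (simp only: B_lincomb_left B_lincomb_right D_lincomb B_sym[of w c]) (simp add: algebra_simps)
    finally show ?thesis using e by (simp add: zero_le_mult_iff)
  qed
  then have "\<forall>\<^sub>F e in at_right 0. 0 \<le> 2 * B c w + e * B w w"
    by (intro eventually_mono[OF eventually_at_right_less])
  moreover have "((\<lambda>e. 2 * B c w + e * B w w) \<longlongrightarrow> 2 * B c w + 0 * B w w) (at_right 0)"
    by (intro tendsto_intros)
  ultimately have "0 \<le> 2 * B c w + 0 * B w w"
    by (intro tendsto_lowerbound[where F="at_right (0::real)"]) auto
  moreover have "B f w = B c w + B w w"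
    using B_lincomb_left[OF c wD wD, of 1 1] by (subst fcw) simp
  ultimately show "0 \<le> B f w" using B_nonneg[OF wD] by simp
qed

text \<open>The squared norm \<open>F\<close> of the excess over 1 vanishes at time 0 by hypothesis
  and must be shown not to grow. \<open>excess_sq_le\<close> bounds its increment by a first order
  term in the approximating form plus a remainder that is \<open>o(h)\<close>. Membership in
  \<open>D\<close> is available at positive times only, hence the separate continuity of
  \<open>F\<close>.\<close>

lemma T_le_1:
  assumes t: "0 \<le> t" and f: "memLp M 2 f" and le: "AE x in M. f x \<le> 1"
  shows "AE x in M. T t f x \<le> 1"
proof -
  define F where "F s = (\<integral>x. (max (T s f x - 1) 0)\<^sup>2 \<partial>M)" for s
  define N where "N = (\<integral>x. (f x)\<^sup>2 \<partial>M)"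
  have N: "0 \<le> N" by (simp add: N_def)
  \<comment> \<open>Contractivity makes \<open>N\<close> a bound independent of the time, so
    exchanging \<open>r\<close> and \<open>s\<close> gives the reverse estimate with the same
    error.\<close>
  have F_le: "F s \<le> F r + e * N + (1 + 1 / e) * (\<integral>x. (T s f x - T r f x)\<^sup>2 \<partial>M)"
    if "0 \<le> r" "0 \<le> s" "0 < e" for r s e
  proof -
    have "e * (\<integral>x. (T r f x)\<^sup>2 \<partial>M) \<le> e * N"
      unfolding N_def using that f by (intro mult_left_mono T_contraction) auto
    then show ?thesis
      using integral_excess_sq_le_epsilon[OF memLp2_T[OF that(1) f] memLp2_T[OF that(2) f] that(3)]
      unfolding F_def by linarith
  qed
  have cont: "continuous_on {0..} F"
    unfolding continuous_on_def
  proof (intro ballI tendstoI)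
    fix r \<delta> :: real assume r: "r \<in> {0..}" and "0 < \<delta>"
    define e where "e = \<delta> / (2 * (N + 1))"
    have e: "0 < e" "e * N \<le> \<delta> / 2"
      using N \<open>0 < \<delta>\<close> by (auto simp: e_def field_simps)
    have "((\<lambda>s. (1 + 1 / e) * (\<integral>x. (T s f x - T r f x)\<^sup>2 \<partial>M)) \<longlongrightarrow> (1 + 1 / e) * 0) (at r within {0..})"
      using r by (intro tendsto_intros T_continuous f) auto
    then have "\<forall>\<^sub>F s in at r within {0..}. (1 + 1 / e) * (\<integral>x. (T s f x - T r f x)\<^sup>2 \<partial>M) < \<delta> / 2"
      using \<open>0 < \<delta>\<close> by (intro order_tendstoD(2)) auto
    moreover have "\<forall>\<^sub>F s in at r within {0..}. s \<in> {0..}"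
      by (auto simp: eventually_at intro!: exI[of _ 1])
    ultimately show "\<forall>\<^sub>F s in at r within {0..}. dist (F s) (F r) < \<delta>"
    proof eventually_elim
      case (elim s)
      have "(\<integral>x. (T r f x - T s f x)\<^sup>2 \<partial>M) = (\<integral>x. (T s f x - T r f x)\<^sup>2 \<partial>M)"
        by (simp add: power2_commute)
      then have "F r \<le> F s + e * N + (1 + 1 / e) * (\<integral>x. (T s f x - T r f x)\<^sup>2 \<partial>M)"
        using F_le[of s r e] elim r e by simp
      moreover have "F s \<le> F r + e * N + (1 + 1 / e) * (\<integral>x. (T s f x - T r f x)\<^sup>2 \<partial>M)"
        using F_le[of r s e] elim r e by simp
      ultimately show ?case
        unfolding dist_real_def abs_less_iff using elim(1) e(2) by linarith
    qed
  qed
  have dini: "\<forall>\<^sub>F h in at_right 0. F (s + h) \<le> F s + e * h" if s: "0 < s" and e: "0 < e" for s e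
  proof -
    define a where "a = T s f"
    define w where "w = (\<lambda>x. max (a x - 1) 0)"
    have aD: "a \<in> D" unfolding a_def by (rule T_in_D[OF s f])
    note w = B_excess_nonneg[OF aD, folded w_def]
    have a: "memLp M 2 a" by (rule D_memLp2[OF aD])
    \<comment> \<open>This expression bounds the difference quotient of \<open>F\<close> at
      \<open>s\<close>. Its limit is nonpositive by \<open>B_excess_nonneg\<close>, hence it is
      eventually below \<open>e\<close>.\<close>
    have "((\<lambda>h. - 2 * (approx_form h a w / h) + (\<integral>x. (T h a x - a x)\<^sup>2 \<partial>M) / h) \<longlongrightarrow> - 2 * B a w + 0)
        (at_right 0)"
      by (intro tendsto_intros approx_form_tendsto T_diff_sq_little_o aD w)
    then have "\<forall>\<^sub>F h in at_right 0. - 2 * (approx_form h a w / h) + (\<integral>x. (T h a x - a x)\<^sup>2 \<partial>M) / h < e"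
      by (rule order_tendstoD(2)) (use w e in simp)
    then show ?thesis
      using eventually_at_right_less[of 0]
    proof eventually_elim
      case (elim h)
      have mT: "memLp M 2 (T h a)" using elim a by (intro memLp2_T) auto
      have "- 2 * approx_form h a w + (\<integral>x. (T h a x - a x)\<^sup>2 \<partial>M) < e * h"
        using elim by (simp add: field_simps)
      moreover have "approx_form h a w = - (\<integral>x. (T h a x - a x) * w x \<partial>M)"
        unfolding approx_form_def by (simp add: algebra_simps flip: Bochner_Integration.integral_minus)
      moreover have "F (s + h) = (\<integral>x. (max (T h a x - 1) 0)\<^sup>2 \<partial>M)"
        unfolding F_def
      proof (rule integral_cong_AE)
        have "AE x in M. T (h + s) f x = T h a x"
          unfolding a_def using elim s f by (intro T_add) auto
        then show "AE x in M. (max (T (s + h) f x - 1) 0)\<^sup>2 = (max (T h a x - 1) 0)\<^sup>2"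
          by eventually_elim (simp add: add.commute)
      qed (use elim s f a in \<open>auto intro!: borel_measurable_power borel_measurable_max borel_measurable_diff T_measurable\<close>)
      moreover have "F s = (\<integral>x. (w x)\<^sup>2 \<partial>M)" by (simp add: F_def w_def a_def)
      ultimately show ?case
        using integral_excess_sq_le[OF a mT] unfolding w_def by simp
    qed
  qed
  have meas: "(\<lambda>x. max (T s f x - 1) 0) \<in> borel_measurable M" if "0 \<le> s" for s
    using memLp_measurable[OF memLp2_excess[OF memLp2_T[OF that f]]] .
  have "F t \<le> F 0" by (rule right_Dini_nonpos_imp_le[OF cont dini t])
  also have "F 0 = (\<integral>x. 0 \<partial>M)"
    unfolding F_def
  proof (rule integral_cong_AE)
    show "AE x in M. (max (T 0 f x - 1) 0)\<^sup>2 = 0"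
      using T_0[OF f] le by eventually_elim simp
  qed (use meas[of 0] in auto)
  finally have "F t = 0" unfolding F_def by (simp add: antisym)
  then have "AE x in M. (max (T t f x - 1) 0)\<^sup>2 = 0"
    unfolding F_def
    using memLp2_excess[OF memLp2_T[OF t f]] by (subst (asm) integral_nonneg_eq_0_iff_AE) (auto simp: memLp2_iff)
  then show ?thesis by eventually_elim (auto simp: max_def split: if_splits)
qed

section \<open>Positivity, and contractivity for the supremum and L^1 norms\<close>

lemma T_le:
  assumes t: "0 \<le> t" and f: "memLp M 2 f" and le: "AE x in M. f x \<le> c" and c: "0 < c"
  shows "AE x in M. T t f x \<le> c"
proof -
  have m: "memLp M 2 (\<lambda>x. inverse c * f x)" using memLp2_lincomb[OF f f, of "inverse c" 0] by simp
  have "AE x in M. inverse c * f x \<le> 1" using le c by (auto simp: field_simps)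
  then have "AE x in M. T t (\<lambda>x. inverse c * f x) x \<le> 1" by (rule T_le_1[OF t m])
  with T_scale[OF t f, of "inverse c"] show ?thesis
  proof eventually_elim
    case (elim x)
    then have "inverse c * T t f x \<le> 1" by simp
    then show ?case using c by (simp add: field_simps)
  qed
qed

text \<open>The level 0 is out of reach of the scaling argument in \<open>T_le\<close>, so
  \<open>- f\<close> is bounded by every \<open>inverse (real (Suc n))\<close> and the limit is
  taken pointwise.\<close>

lemma T_nonneg:
  assumes t: "0 \<le> t" and f: "memLp M 2 f" and le: "AE x in M. 0 \<le> f x"
  shows "AE x in M. 0 \<le> T t f x"
proof -
  have m: "memLp M 2 (\<lambda>x. - 1 * f x)" using memLp2_lincomb[OF f f, of "-1" 0] by simp
  have "AE x in M. \<forall>n. T t (\<lambda>x. - 1 * f x) x \<le> inverse (real (Suc n))"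
    unfolding AE_all_countable
  proof
    fix n
    show "AE x in M. T t (\<lambda>x. - 1 * f x) x \<le> inverse (real (Suc n))"
      using le by (intro T_le[OF t m]) (auto elim!: eventually_mono intro: order_trans[of _ 0])
  qed
  with T_scale[OF t f, of "-1"] show ?thesis
  proof eventually_elim
    case (elim x)
    have "- T t f x \<le> 0"
    proof (rule LIMSEQ_le_const[OF LIMSEQ_inverse_real_of_nat])
      show "\<exists>N. \<forall>n\<ge>N. - T t f x \<le> inverse (real (Suc n))" using elim by simp
    qed
    then show ?case by simp
  qed
qed

lemma T_mono:
  assumes t: "0 \<le> t" and m: "memLp M 2 f" "memLp M 2 g" and le: "AE x in M. f x \<le> g x"
  shows "AE x in M. T t f x \<le> T t g x"
proof -
  have "AE x in M. 0 \<le> T t (\<lambda>x. g x - f x) x"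
    using le by (intro T_nonneg t memLp2_diff m) simp
  with T_diff[OF t m(2,1)] show ?thesis by eventually_elim simp
qed

lemma abs_T_le:
  assumes t: "0 \<le> t" and f: "memLp M 2 f"
  shows "AE x in M. \<bar>T t f x\<bar> \<le> T t (\<lambda>y. \<bar>f y\<bar>) x"
proof -
  have m: "memLp M 2 (\<lambda>x. - 1 * f x)" using memLp2_lincomb[OF f f, of "-1" 0] by simp
  have "AE x in M. T t f x \<le> T t (\<lambda>y. \<bar>f y\<bar>) x"
    by (rule T_mono[OF t f memLp2_abs[OF f]]) auto
  moreover have "AE x in M. T t (\<lambda>x. - 1 * f x) x \<le> T t (\<lambda>y. \<bar>f y\<bar>) x"
    by (rule T_mono[OF t m memLp2_abs[OF f]]) auto
  ultimately show ?thesis using T_scale[OF t f, of "-1"] by eventually_elim auto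
qed

lemma abs_T_le_const:
  assumes t: "0 \<le> t" and f: "memLp M 2 f" and le: "AE x in M. \<bar>f x\<bar> \<le> c" and c: "0 < c"
  shows "AE x in M. \<bar>T t f x\<bar> \<le> c"
  using abs_T_le[OF t f] T_le[OF t memLp2_abs[OF f] le c] by eventually_elim auto

text \<open>Formally the integral of \<open>T t g\<close> is that of \<open>g * T t 1\<close>, and
  \<open>T t 1 <= 1\<close>. As the constant 1 need not lie in L^2, indicators of an exhaustion by
  sets of finite measure replace it, and monotone convergence gives the limit.\<close>

lemma T_nonneg_L1:
  assumes t: "0 \<le> t" and g: "memLp M 2 g" "integrable M g" "AE x in M. 0 \<le> g x"
  shows "integrable M (T t g)" "(\<integral>x. T t g x \<partial>M) \<le> (\<integral>x. g x \<partial>M)"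
proof -
  obtain A :: "nat \<Rightarrow> 'a set" where A: "range A \<subseteq> sets M" "(\<Union>i. A i) = space M"
      "\<And>i. emeasure M (A i) \<noteq> \<infinity>" "incseq A"
    using sigma_finite_incseq by blast
  have As [measurable]: "A i \<in> sets M" for i using A(1) by auto
  have Ai: "memLp M 2 (indicator (A i))" for i
    using A by (intro memLp2_indicator) (auto simp: less_top)
  have Tg: "memLp M 2 (T t g)" by (rule memLp2_T[OF t g(1)])
  note [measurable] = memLp_measurable[OF Tg] memLp_measurable[OF g(1)]
  have pos: "AE x in M. 0 \<le> T t g x" by (rule T_nonneg[OF t g(1,3)])
  have le: "(\<integral>x. T t g x * indicator (A i) x \<partial>M) \<le> (\<integral>x. g x \<partial>M)" for i
  proof -
    have "AE x in M. T t (indicator (A i)) x \<le> 1"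
      by (rule T_le_1[OF t Ai]) (auto simp: indicator_def)
    with g(3) have "AE x in M. g x * T t (indicator (A i)) x \<le> g x"
      by eventually_elim (simp add: mult_left_le)
    then have "(\<integral>x. g x * T t (indicator (A i)) x \<partial>M) \<le> (\<integral>x. g x \<partial>M)"
      by (intro integral_mono_AE memLp2_mult_integrable g memLp2_T t Ai)
    then show ?thesis by (simp add: T_symmetric[OF t g(1) Ai])
  qed
  have nn: "(\<integral>\<^sup>+x. ennreal (T t g x) \<partial>M) \<le> ennreal (\<integral>x. g x \<partial>M)"
  proof -
    have "(\<integral>\<^sup>+x. ennreal (T t g x) \<partial>M) = (\<integral>\<^sup>+x. (SUP i. ennreal (T t g x * indicator (A i) x)) \<partial>M)"
    proof (rule nn_integral_cong_AE, use pos AE_space in eventually_elim)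
      fix x assume x: "x \<in> space M" "0 \<le> T t g x"
      then obtain i where "x \<in> A i" using A(2) by auto
      then show "ennreal (T t g x) = (SUP i. ennreal (T t g x * indicator (A i) x))"
        using x by (intro antisym SUP_upper2[of i] SUP_least) (auto simp: indicator_def)
    qed
    also have "\<dots> = (SUP i. \<integral>\<^sup>+x. ennreal (T t g x * indicator (A i) x) \<partial>M)"
    proof (rule nn_integral_monotone_convergence_SUP_AE)
      fix i
      show "AE x in M. ennreal (T t g x * indicator (A i) x) \<le> ennreal (T t g x * indicator (A (Suc i)) x)"
        using pos A(4) by (auto simp: indicator_def incseq_Suc_iff elim!: eventually_mono)
    qed simp
    also have "\<dots> \<le> ennreal (\<integral>x. g x \<partial>M)"
    proof (rule SUP_least)
      fix i
      have "(\<integral>\<^sup>+x. ennreal (T t g x * indicator (A i) x) \<partial>M) = ennreal (\<integral>x. T t g x * indicator (A i) x \<partial>M)"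
        using pos by (intro nn_integral_eq_integral memLp2_mult_integrable Tg Ai) auto
      with le[of i] show "(\<integral>\<^sup>+x. ennreal (T t g x * indicator (A i) x) \<partial>M) \<le> ennreal (\<integral>x. g x \<partial>M)"
        by (simp add: ennreal_leI)
    qed
    finally show ?thesis .
  qed
  show int: "integrable M (T t g)"
    by (rule integrableI_nonneg) (use pos nn in \<open>auto simp: le_less_trans\<close>)
  have "ennreal (\<integral>x. T t g x \<partial>M) \<le> ennreal (\<integral>x. g x \<partial>M)"
    using nn nn_integral_eq_integral[OF int pos] by simp
  moreover have "0 \<le> (\<integral>x. g x \<partial>M)" by (rule integral_nonneg_AE[OF g(3)])
  ultimately show "(\<integral>x. T t g x \<partial>M) \<le> (\<integral>x. g x \<partial>M)" by simp
qed

lemma T_L1: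
  assumes t: "0 \<le> t" and g: "memLp M 2 g" "integrable M g"
  shows "integrable M (T t g)" "(\<integral>x. \<bar>T t g x\<bar> \<partial>M) \<le> (\<integral>x. \<bar>g x\<bar> \<partial>M)"
proof -
  note ab = T_nonneg_L1[OF t memLp2_abs[OF g(1)] integrable_abs[OF g(2)]]
  show int: "integrable M (T t g)"
  proof (rule Bochner_Integration.integrable_bound)
    show "integrable M (T t (\<lambda>y. \<bar>g y\<bar>))" by (rule ab) simp
    show "AE x in M. norm (T t g x) \<le> norm (T t (\<lambda>y. \<bar>g y\<bar>) x)"
      using abs_T_le[OF t g(1)] by eventually_elim simp
  qed (rule T_measurable[OF t g(1)])
  have "(\<integral>x. \<bar>T t g x\<bar> \<partial>M) \<le> (\<integral>x. T t (\<lambda>y. \<bar>g y\<bar>) x \<partial>M)"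
    using int ab(1) abs_T_le[OF t g(1)] by (intro integral_mono_AE) auto
  also have "\<dots> \<le> (\<integral>x. \<bar>g x\<bar> \<partial>M)" by (rule ab) simp
  finally show "(\<integral>x. \<bar>T t g x\<bar> \<partial>M) \<le> (\<integral>x. \<bar>g x\<bar> \<partial>M)" .
qed

section \<open>Harmonic functions\<close>

text \<open>Bounded integrable functions serve as test functions for every exponent
  \<open>p\<close>. The semigroup preserves this class without increasing the bound \<open>K\<close>
  or the L^1 norm, so estimates against \<open>T t w\<close> are uniform in
  \<open>t\<close>.\<close>

lemma T_bounded_L1:
  assumes "0 \<le> t" "integrable M w" "AE x in M. \<bar>w x\<bar> \<le> K" "0 < K"
  shows "integrable M (T t w)" "AE x in M. \<bar>T t w x\<bar> \<le> K"
    "(\<integral>x. \<bar>T t w x\<bar> \<partial>M) \<le> (\<integral>x. \<bar>w x\<bar> \<partial>M)"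
  using bounded_L1_imp_memLp2[OF assms(2,3)] assms by (blast intro: T_L1 abs_T_le_const)+

text \<open>The identity is symmetry of \<open>T t\<close> for \<open>f\<close> in both L^p and L^2.
  Both sides are continuous in \<open>f\<close> for the L^p norm, the left one by boundedness of
  \<open>Tp t\<close>, and such \<open>f\<close> are dense.\<close>

lemma Lp_extension_symmetric:
  assumes p: "1 \<le> p" and ext: "Lp_extension M p T Tp" and t: "0 \<le> t" and f: "memLp M p f"
    and w: "integrable M w" "AE x in M. \<bar>w x\<bar> \<le> K" "0 < K"
  shows "(\<integral>x. Tp t f x * w x \<partial>M) = (\<integral>x. f x * T t w x \<partial>M)"
proof -
  note ext' = ext[unfolded Lp_extension_def]
  have Tp_mem: "memLp M p (Tp t g)" if "memLp M p g" for g
    using ext'[THEN conjunct1] t that by blast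
  have Tp_diff: "AE x in M. Tp t (\<lambda>y. g y - h y) x = Tp t g x - Tp t h x"
    if "memLp M p g" "memLp M p h" for g h
  proof -
    have "AE x in M. Tp t (\<lambda>y. 1 * g y + (-1) * h y) x = 1 * Tp t g x + (-1) * Tp t h x"
      using ext'[THEN conjunct2, THEN conjunct1] t that by blast
    then show ?thesis by simp
  qed
  have Tp_eq: "AE x in M. Tp t g x = T t g x" if "memLp M p g" "memLp M 2 g" for g
    using ext'[THEN conjunct2, THEN conjunct2, THEN conjunct2] t that by blast
  obtain C where C: "\<And>g. memLp M p g \<Longrightarrow> Lpnorm M p (Tp t g) \<le> C * Lpnorm M p g"
    using ext'[THEN conjunct2, THEN conjunct2, THEN conjunct1] t by blast
  obtain u where u: "\<And>n. memLp M p (u n)" "\<And>n. memLp M 2 (u n)"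
    "(\<lambda>n. \<integral>x. \<bar>u n x - f x\<bar> powr p \<partial>M) \<longlonglongrightarrow> 0"
    by (rule Lp_approx_by_L2[OF p f]) blast
  define r where "r n x = u n x - f x" for n x
  have r: "memLp M p (r n)" for n
    unfolding r_def using memLp_diff[OF u(1) f] p by simp
  have r0: "(\<lambda>n. Lpnorm M p (r n)) \<longlonglongrightarrow> 0"
    using u(3) p by (simp add: Lpnorm_tendsto_0_iff r_def)
  have w2: "memLp M 2 w" by (rule bounded_L1_imp_memLp2[OF w(1,2)])
  note Tw = T_bounded_L1[OF t w]
  have lim1: "(\<lambda>n. \<integral>x. r n x * T t w x \<partial>M) \<longlonglongrightarrow> 0"
    by (rule tendsto_integral_mult_Lp[OF p r Tw(1,2)]) (use u(3) in \<open>simp add: r_def\<close>)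
  have "(\<lambda>n. Lpnorm M p (Tp t (r n))) \<longlonglongrightarrow> 0"
  proof (rule tendsto_sandwich[where f="\<lambda>_. 0" and h="\<lambda>n. C * Lpnorm M p (r n)"])
    show "(\<lambda>n. C * Lpnorm M p (r n)) \<longlonglongrightarrow> 0" using tendsto_mult_right_zero[OF r0] .
    show "\<forall>\<^sub>F n in sequentially. 0 \<le> Lpnorm M p (Tp t (r n))" by (simp add: Lpnorm_def)
    show "\<forall>\<^sub>F n in sequentially. Lpnorm M p (Tp t (r n)) \<le> C * Lpnorm M p (r n)" using C r by simp
  qed simp
  then have lim2: "(\<lambda>n. \<integral>x. Tp t (r n) x * w x \<partial>M) \<longlonglongrightarrow> 0"
    using p by (intro tendsto_integral_mult_Lp[OF p Tp_mem[OF r] w(1,2)]) (simp add: Lpnorm_tendsto_0_iff)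
  have 1: "(\<integral>x. r n x * T t w x \<partial>M) = (\<integral>x. u n x * T t w x \<partial>M) - (\<integral>x. f x * T t w x \<partial>M)" for n
    unfolding r_def left_diff_distrib
    by (intro Bochner_Integration.integral_diff memLp_mult_bounded_L1(1)[OF p _ Tw(1,2)] u f)
  have 2: "(\<integral>x. Tp t (r n) x * w x \<partial>M) = (\<integral>x. u n x * T t w x \<partial>M) - (\<integral>x. Tp t f x * w x \<partial>M)" for n
  proof -
    note wi = memLp_mult_bounded_L1(1)[OF p _ w(1,2)]
    have "(\<integral>x. Tp t (r n) x * w x \<partial>M) = (\<integral>x. Tp t (u n) x * w x - Tp t f x * w x \<partial>M)"
    proof (rule integral_cong_AE)
      show "AE x in M. Tp t (r n) x * w x = Tp t (u n) x * w x - Tp t f x * w x"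
        using Tp_diff[OF u(1)[of n] f] unfolding r_def by eventually_elim (simp add: left_diff_distrib)
    qed (auto intro!: borel_measurable_diff borel_measurable_integrable[OF wi] Tp_mem r u f)
    also have "\<dots> = (\<integral>x. Tp t (u n) x * w x \<partial>M) - (\<integral>x. Tp t f x * w x \<partial>M)"
      by (intro Bochner_Integration.integral_diff wi Tp_mem u f)
    also have "(\<integral>x. Tp t (u n) x * w x \<partial>M) = (\<integral>x. T t (u n) x * w x \<partial>M)"
    proof (rule integral_cong_AE)
      show "AE x in M. Tp t (u n) x * w x = T t (u n) x * w x"
        using Tp_eq[OF u(1,2)[of n]] by eventually_elim simp
    qed (intro borel_measurable_times memLp_measurable[OF w2] memLp_measurable[OF Tp_mem[OF u(1)]]
        T_measurable t u)+
    also have "\<dots> = (\<integral>x. u n x * T t w x \<partial>M)" by (rule T_symmetric[OF t u(2) w2])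
    finally show ?thesis .
  qed
  \<comment> \<open>The terms with \<open>u n\<close> cancel between \<open>1\<close> and
    \<open>2\<close>, so this sequence is constant, equal to the difference of the two sides of the
    claim.\<close>
  have "(\<lambda>n. (\<integral>x. r n x * T t w x \<partial>M) - (\<integral>x. Tp t (r n) x * w x \<partial>M)) \<longlonglongrightarrow> 0 - 0"
    by (intro tendsto_diff lim1 lim2)
  then show ?thesis unfolding 1 2 by (simp add: LIMSEQ_const_iff)
qed

text \<open>This is invariance of \<open>f\<close> under the semigroup, with the operator moved to
  the test function. The L^p extension drops out, and only the L^2 semigroup remains in what
  follows.\<close>

definition weakly_harmonic :: "real \<Rightarrow> ('a \<Rightarrow> real) \<Rightarrow> bool" where
  "weakly_harmonic p f \<longleftrightarrow> memLp M p f \<and>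
     (\<forall>t\<ge>0. \<forall>w K. integrable M w \<and> (AE x in M. \<bar>w x\<bar> \<le> K) \<and> 0 < K \<longrightarrow>
        (\<integral>x. f x * T t w x \<partial>M) = (\<integral>x. f x * w x \<partial>M))"

lemma weakly_harmonicD:
  assumes "weakly_harmonic p f" "0 \<le> t" "integrable M w" "AE x in M. \<bar>w x\<bar> \<le> K" "0 < K"
  shows "(\<integral>x. f x * T t w x \<partial>M) = (\<integral>x. f x * w x \<partial>M)"
  using assms(1)[unfolded weakly_harmonic_def, THEN conjunct2] assms(2-) by blast

text \<open>Formally \<open>J\<close> has derivative zero, because it is minus the pairing of
  \<open>L_p f = 0\<close> with \<open>T s w\<close>. Instead of differentiating,
  \<open>[0, t]\<close> is cut into equal steps and the increments are summed.\<close>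

lemma Lp_harmonic_imp_weakly_harmonic:
  assumes p: "1 \<le> p" and ext: "Lp_extension M p T Tp" and harm: "Lp_harmonic M p Tp f"
  shows "weakly_harmonic p f"
  unfolding weakly_harmonic_def
proof (intro conjI allI impI)
  show f: "memLp M p f" using harm by (simp add: Lp_harmonic_def)
  fix t K :: real and w :: "'a \<Rightarrow> real"
  assume t: "0 \<le> t" and "integrable M w \<and> (AE x in M. \<bar>w x\<bar> \<le> K) \<and> 0 < K"
  then have w: "integrable M w" "AE x in M. \<bar>w x\<bar> \<le> K" "0 < K" by auto
  have w2: "memLp M 2 w" by (rule bounded_L1_imp_memLp2[OF w(1,2)])
  define J where "J s = (\<integral>x. f x * T s w x \<partial>M)" for s
  define r where "r h x = (f x - Tp h f x) / h" for h x
  define W where "W = (\<integral>x. \<bar>w x\<bar> \<partial>M)"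
  define R where "R h = (\<integral>x. \<bar>r h x\<bar> powr p \<partial>M)" for h
  have R: "(R \<longlongrightarrow> 0) (at_right 0)"
    using harm p unfolding Lp_harmonic_def R_def r_def by (simp add: Lpnorm_tendsto_0_iff)
  have Tp_mem: "memLp M p (Tp h f)" if "0 < h" for h
    using ext[unfolded Lp_extension_def, THEN conjunct1] f that by auto
  have r: "memLp M p (r h)" if "0 < h" for h
    unfolding r_def using memLp_scale[OF memLp_diff[OF f Tp_mem[OF that]], of "1 / h"] p by simp
  \<comment> \<open>The increment is \<open>h\<close> times the pairing of the difference quotient
    \<open>r h\<close> with \<open>T s w\<close>. The bound is free of \<open>s\<close>, which makes
    it summable over all steps.\<close>
  have step: "\<bar>J (s + h) - J s\<bar> \<le> h * (e * W + K * e powr (1 - p) * R h)"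
    if s: "0 \<le> s" and h: "0 < h" and e: "0 < e" for s h e
  proof -
    note Tw = T_bounded_L1[OF s w]
    note wi = memLp_mult_bounded_L1(1)[OF p _ Tw(1,2)]
    have "J (s + h) = (\<integral>x. f x * T h (T s w) x \<partial>M)"
      unfolding J_def
    proof (rule integral_cong_AE)
      have "AE x in M. T (h + s) w x = T h (T s w) x"
        using s h w2 by (intro T_add) auto
      then show "AE x in M. f x * T (s + h) w x = f x * T h (T s w) x"
        by eventually_elim (simp add: add.commute)
    qed (use s h f w2 in \<open>auto intro!: borel_measurable_times T_measurable memLp2_T memLp_measurable[OF f]\<close>)
    also have "\<dots> = (\<integral>x. Tp h f x * T s w x \<partial>M)"
      using h by (intro Lp_extension_symmetric[OF p ext _ f Tw(1,2) w(3), symmetric]) auto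
    finally have "J s - J (s + h) = (\<integral>x. f x * T s w x - Tp h f x * T s w x \<partial>M)"
      unfolding J_def by (simp add: wi f Tp_mem[OF h])
    also have "\<dots> = (\<integral>x. h * (r h x * T s w x) \<partial>M)"
      using h by (intro Bochner_Integration.integral_cong) (auto simp: r_def left_diff_distrib)
    also have "\<dots> = h * (\<integral>x. r h x * T s w x \<partial>M)" by simp
    finally have "\<bar>J (s + h) - J s\<bar> = h * \<bar>\<integral>x. r h x * T s w x \<partial>M\<bar>"
      using h by (simp add: abs_minus_commute abs_mult)
    also have "\<dots> \<le> h * (e * (\<integral>x. \<bar>T s w x\<bar> \<partial>M) + K * e powr (1 - p) * R h)"
      unfolding R_def using h by (intro mult_left_mono memLp_mult_bounded_L1(2)[OF p r[OF h] Tw(1,2) e]) auto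
    also have "\<dots> \<le> h * (e * W + K * e powr (1 - p) * R h)"
      unfolding W_def using h e Tw(3) by (intro mult_left_mono add_right_mono) auto
    finally show ?thesis .
  qed
  have "J t = J 0"
  proof (cases "t = 0")
    case False
    with t have t: "0 < t" by simp
    have tele: "\<bar>J t - J 0\<bar> \<le> t * (e * W + K * e powr (1 - p) * R (t / real (Suc n)))" if e: "0 < e" for e n
    proof -
      define h where "h = t / real (Suc n)"
      have h: "0 < h" using t by (simp add: h_def)
      have "\<bar>J (real k * h) - J 0\<bar> \<le> real k * (h * (e * W + K * e powr (1 - p) * R h))" for k
      proof (induction k)
        case (Suc k)
        have "\<bar>J (real k * h + h) - J (real k * h)\<bar> \<le> h * (e * W + K * e powr (1 - p) * R h)"
          using h e by (intro step) auto
        with Suc show ?case by (simp add: algebra_simps)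
      qed simp
      from this[of "Suc n"] show ?thesis by (simp add: h_def)
    qed
    \<comment> \<open>The mesh tends to 0 with \<open>e\<close> fixed, which removes the term with
      \<open>R\<close>; only afterwards does \<open>e\<close> tend to 0.\<close>
    have "\<bar>J t - J 0\<bar> \<le> t * (e * W)" if e: "0 < e" for e
    proof (rule LIMSEQ_le_const)
      have "filterlim (\<lambda>n. t / real (Suc n)) (at_right 0) sequentially"
        using t LIMSEQ_Suc[OF lim_const_over_n[of t]] by (auto simp: filterlim_at)
      then have "(\<lambda>n. t * (e * W + K * e powr (1 - p) * R (t / real (Suc n)))) \<longlonglongrightarrow>
          t * (e * W + K * e powr (1 - p) * 0)"
        by (intro tendsto_intros filterlim_compose[OF R])
      then show "(\<lambda>n. t * (e * W + K * e powr (1 - p) * R (t / real (Suc n)))) \<longlonglongrightarrow> t * (e * W)"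
        by simp
    qed (use tele[OF e] in blast)
    then have "\<forall>\<^sub>F e in at_right 0. \<bar>J t - J 0\<bar> \<le> t * (e * W)"
      by (intro eventually_mono[OF eventually_at_right_less])
    moreover have "((\<lambda>e. t * (e * W)) \<longlongrightarrow> t * (0 * W)) (at_right 0)"
      by (intro tendsto_intros)
    ultimately have "\<bar>J t - J 0\<bar> \<le> t * (0 * W)"
      by (intro tendsto_lowerbound[where F="at_right (0::real)"]) auto
    then show ?thesis by simp
  qed simp
  also have "J 0 = (\<integral>x. f x * w x \<partial>M)"
    unfolding J_def
  proof (rule integral_cong_AE)
    show "AE x in M. f x * T 0 w x = f x * w x" using T_0[OF w2] by eventually_elim simp
  qed (use f w w2 in \<open>auto intro!: borel_measurable_times T_measurable memLp_measurable[OF f]\<close>)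
  finally show "(\<integral>x. f x * T t w x \<partial>M) = (\<integral>x. f x * w x \<partial>M)" unfolding J_def .
qed

section \<open>Level sets of harmonic functions and their invariance\<close>

lemma weakly_harmonic_uminus: "weakly_harmonic p f \<Longrightarrow> weakly_harmonic p (\<lambda>x. - f x)"
  unfolding weakly_harmonic_def by (auto simp: memLp_def)

text \<open>Splitting \<open>f\<close> at height \<open>c\<close>, both pieces pair with \<open>T t 1\<^sub>A\<close> to at most their
  pairing with \<open>1\<^sub>A\<close>; harmonicity says that the sums agree, so both bounds are attained.\<close>

lemma weakly_harmonic_level_set:
  assumes p: "1 \<le> p" and f: "weakly_harmonic p f" and c: "0 < c" and t: "0 \<le> t"
  defines "A \<equiv> {x \<in> space M. c < f x}"
  shows "A \<in> sets M" "emeasure M A < \<infinity>" "AE x in M. T t (indicator A) x = indicator A x"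
proof -
  have fp: "memLp M p f" using f by (simp add: weakly_harmonic_def)
  note [measurable] = memLp_measurable[OF fp]
  show A [measurable]: "A \<in> sets M" unfolding A_def by simp
  have intA: "integrable M (indicator A :: 'a \<Rightarrow> real)"
  proof (rule Bochner_Integration.integrable_bound)
    show "integrable M (\<lambda>x. inverse (c powr p) * \<bar>f x\<bar> powr p)" using fp by (simp add: memLp_def)
    \<comment> \<open>Chebyshev's inequality, the reason why levels \<open>c > 0\<close> are
      used.\<close>
    have "indicator A x \<le> inverse (c powr p) * \<bar>f x\<bar> powr p" for x
    proof (cases "x \<in> A")
      case True
      then have "c powr p \<le> \<bar>f x\<bar> powr p" using c p by (intro powr_mono2) (auto simp: A_def)
      then show ?thesis using c True by (simp add: field_simps)
    qed simp
    then show "AE x in M. norm (indicator A x :: real) \<le> norm (inverse (c powr p) * \<bar>f x\<bar> powr p)"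
      by simp
  qed simp
  then show fin: "emeasure M A < \<infinity>" by (simp add: integrable_indicator_iff)
  define u where "u = T t (indicator A)"
  have A2: "memLp M 2 (indicator A)" by (rule memLp2_indicator[OF A fin])
  have bnd: "AE x in M. \<bar>indicator A x :: real\<bar> \<le> 1" by (auto simp: indicator_def)
  note ub = T_bounded_L1[OF t intA bnd zero_less_one, folded u_def]
  have u0: "AE x in M. 0 \<le> u x" unfolding u_def by (rule T_nonneg[OF t A2]) auto
  have u_int: "(\<integral>x. u x \<partial>M) \<le> (\<integral>x. indicator A x \<partial>M)"
    unfolding u_def by (rule T_nonneg_L1[OF t A2 intA]) auto
  define v where "v x = max (f x - c) 0" for x
  have vp: "memLp M p v"
  proof (rule memLp_bound[OF fp])
    show "v \<in> borel_measurable M" unfolding v_def by measurable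
  qed (use c p in \<open>auto simp: v_def\<close>)
  note wu = memLp_mult_bounded_L1(1)[OF p _ ub(1,2)]
  note wA = memLp_mult_bounded_L1(1)[OF p _ intA bnd]
  have vA: "v x * indicator A x = v x" if "x \<in> space M" for x
    using that by (auto simp: v_def A_def indicator_def)
  have int_v: "integrable M v" using wA[OF vp] by (subst (asm) Bochner_Integration.integrable_cong[OF refl vA]) auto
  \<comment> \<open>As \<open>v\<close> vanishes off \<open>A\<close>, this is
    \<open>(v x + c) * (indicator A x - u x)\<close>. It lies below
    \<open>f x * (indicator A x - u x)\<close>, since \<open>f = v + c\<close> on \<open>A\<close>,
    \<open>f <= v + c\<close> everywhere and \<open>u\<close> is nonnegative.\<close>
  define d where "d x = v x * (1 - u x) + c * (indicator A x - u x)" for x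
  have int_vu: "integrable M (\<lambda>x. v x * (1 - u x))"
    using int_v wu[OF vp] by (simp add: right_diff_distrib)
  have "(\<integral>x. v x * (1 - u x) \<partial>M) + c * ((\<integral>x. indicator A x \<partial>M) - (\<integral>x. u x \<partial>M)) = (\<integral>x. d x \<partial>M)"
    unfolding d_def using int_vu intA ub(1) by simp
  also have "\<dots> \<le> (\<integral>x. f x * indicator A x - f x * u x \<partial>M)"
  proof (rule integral_mono_AE)
    show "integrable M d" unfolding d_def using int_vu intA ub(1) by simp
    show "integrable M (\<lambda>x. f x * indicator A x - f x * u x)" using wu wA fp by simp
    show "AE x in M. d x \<le> f x * indicator A x - f x * u x"
      using u0 AE_space
    proof eventually_elim
      case (elim x)
      have "f x * u x \<le> (v x + c) * u x"
        using elim by (intro mult_right_mono) (auto simp: v_def)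
      moreover have "f x * indicator A x = v x + c * indicator A x"
        using elim by (auto simp: v_def A_def indicator_def)
      ultimately show ?case by (simp add: d_def algebra_simps)
    qed
  qed
  also have "\<dots> = (\<integral>x. f x * indicator A x \<partial>M) - (\<integral>x. f x * u x \<partial>M)"
    using wu wA fp by simp
  also have "\<dots> = 0"
  proof -
    have "(\<integral>x. f x * u x \<partial>M) = (\<integral>x. f x * indicator A x \<partial>M)"
      unfolding u_def by (rule weakly_harmonicD[OF f t intA bnd zero_less_one])
    then show ?thesis by simp
  qed
  finally have le: "(\<integral>x. v x * (1 - u x) \<partial>M) + c * ((\<integral>x. indicator A x \<partial>M) - (\<integral>x. u x \<partial>M)) \<le> 0" .
  have nn: "AE x in M. 0 \<le> v x * (1 - u x)"
    using ub(2) by eventually_elim (auto simp: v_def)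
  then have "0 \<le> (\<integral>x. v x * (1 - u x) \<partial>M)" by (rule integral_nonneg_AE)
  moreover have "0 \<le> c * ((\<integral>x. indicator A x \<partial>M) - (\<integral>x. u x \<partial>M))" using c u_int by simp
  ultimately have "(\<integral>x. v x * (1 - u x) \<partial>M) = 0" "c * ((\<integral>x. indicator A x \<partial>M) - (\<integral>x. u x \<partial>M)) = 0"
    using le by linarith+
  then have "(\<integral>x. v x * (1 - u x) \<partial>M) = 0" and eq: "(\<integral>x. indicator A x \<partial>M) = (\<integral>x. u x \<partial>M)"
    using c by simp_all
  then have "AE x in M. v x * (1 - u x) = 0"
    using integral_nonneg_eq_0_iff_AE[OF int_vu nn] by simp
  \<comment> \<open>On \<open>A\<close> the factor \<open>v\<close> is positive, which forces
    \<open>u = 1\<close> there. Equality of the integrals of \<open>u\<close> and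
    \<open>indicator A\<close> then rules out any mass of \<open>u\<close> off
    \<open>A\<close>.\<close>
  with u0 have ge: "AE x in M. 0 \<le> u x - indicator A x"
    by eventually_elim (auto simp: v_def A_def indicator_def max_def split: if_splits)
  have "(\<integral>x. u x - indicator A x \<partial>M) = 0" using eq ub(1) intA by simp
  then have "AE x in M. u x - indicator A x = 0"
    using integral_nonneg_eq_0_iff_AE[OF _ ge] ub(1) intA by simp
  then show "AE x in M. T t (indicator A) x = indicator A x" unfolding u_def by simp
qed

text \<open>For \<open>q\<close> vanishing on \<open>A\<close>, symmetry turns the integral of
  \<open>T t \<bar>q\<bar>\<close> over \<open>A\<close> into that of
  \<open>\<bar>q\<bar> * indicator A\<close>, which is zero. For the second claim the complement of
  \<open>A\<close> may have infinite measure, so it is covered by the sets \<open>E i - A\<close>,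
  to whose indicators the first claim applies.\<close>

lemma T_indicator_fixed_imp_T_vanishes:
  assumes t: "0 \<le> t" and A: "A \<in> sets M" "emeasure M A < \<infinity>"
    and fixed: "AE x in M. T t (indicator A) x = indicator A x"
    and g: "memLp M 2 g"
  shows "AE x in M. x \<in> A \<longrightarrow> T t (\<lambda>y. indicator (space M - A) y * g y) x = 0"
    and "AE x in M. x \<notin> A \<longrightarrow> T t (\<lambda>y. indicator A y * g y) x = 0"
proof -
  have As [measurable]: "A \<in> sets M" "space M - A \<in> sets M" using A by auto
  have A2: "memLp M 2 (indicator A)" by (rule memLp2_indicator[OF A])
  have off: "AE x in M. x \<in> A \<longrightarrow> T t (\<lambda>y. indicator (space M - A) y * k y) x = 0" if k: "memLp M 2 k" for k
  proof -
    define q where "q y = indicator (space M - A) y * k y" for y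
    have q: "memLp M 2 q" unfolding q_def by (rule memLp2_indicator_mult[OF k As(2)])
    note qa = memLp2_abs[OF q]
    have int: "integrable M (\<lambda>x. T t (\<lambda>y. \<bar>q y\<bar>) x * indicator A x)"
      by (intro memLp2_mult_integrable memLp2_T t qa A2)
    have pos: "AE x in M. 0 \<le> T t (\<lambda>y. \<bar>q y\<bar>) x" by (rule T_nonneg[OF t qa]) simp
    then have pos': "AE x in M. 0 \<le> T t (\<lambda>y. \<bar>q y\<bar>) x * indicator A x" by eventually_elim simp
    have "(\<integral>x. T t (\<lambda>y. \<bar>q y\<bar>) x * indicator A x \<partial>M) = (\<integral>x. \<bar>q x\<bar> * T t (indicator A) x \<partial>M)"
      by (rule T_symmetric[OF t qa A2])
    also have "\<dots> = 0"
    proof (rule integral_eq_zero_AE)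
      show "AE x in M. \<bar>q x\<bar> * T t (indicator A) x = 0"
        using fixed by eventually_elim (auto simp: q_def indicator_def)
    qed
    finally have "AE x in M. T t (\<lambda>y. \<bar>q y\<bar>) x * indicator A x = 0"
      using integral_nonneg_eq_0_iff_AE[OF int pos'] by simp
    with abs_T_le[OF t q] show ?thesis
      unfolding q_def by eventually_elim (auto simp: indicator_def)
  qed
  show "AE x in M. x \<in> A \<longrightarrow> T t (\<lambda>y. indicator (space M - A) y * g y) x = 0"
    by (rule off[OF g])
  obtain E :: "nat \<Rightarrow> 'a set" where E: "range E \<subseteq> sets M" "(\<Union>i. E i) = space M"
      "\<And>i. emeasure M (E i) \<noteq> \<infinity>"
    using sigma_finite by blast
  define q where "q y = indicator A y * g y" for y
  have q: "memLp M 2 q" unfolding q_def by (rule memLp2_indicator_mult[OF g As(1)])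
  note qa = memLp2_abs[OF q]
  have pos: "AE x in M. 0 \<le> T t (\<lambda>y. \<bar>q y\<bar>) x" by (rule T_nonneg[OF t qa]) simp
  have "AE x in M. \<forall>i. T t (\<lambda>y. \<bar>q y\<bar>) x * indicator (E i - A) x = 0"
    unfolding AE_all_countable
  proof
    fix i
    have Ei: "E i \<in> sets M" "E i \<subseteq> space M" using E by auto
    have E2: "memLp M 2 (indicator (E i))" using E Ei by (intro memLp2_indicator) (auto simp: less_top)
    have E2': "memLp M 2 (indicator (E i - A))"
      by (rule memLp2_bound[OF E2]) (use Ei in \<open>auto simp: indicator_def\<close>)
    have int: "integrable M (\<lambda>x. T t (\<lambda>y. \<bar>q y\<bar>) x * indicator (E i - A) x)"
      by (intro memLp2_mult_integrable memLp2_T t qa E2')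
    have pos': "AE x in M. 0 \<le> T t (\<lambda>y. \<bar>q y\<bar>) x * indicator (E i - A) x"
      using pos by eventually_elim simp
    have "(\<lambda>y. indicator (space M - A) y * indicator (E i) y) = (indicator (E i - A) :: 'a \<Rightarrow> real)"
      using Ei by (auto simp: indicator_def fun_eq_iff)
    then have van: "AE x in M. x \<in> A \<longrightarrow> T t (indicator (E i - A)) x = 0"
      using off[OF E2] by simp
    have "(\<integral>x. T t (\<lambda>y. \<bar>q y\<bar>) x * indicator (E i - A) x \<partial>M) = (\<integral>x. \<bar>q x\<bar> * T t (indicator (E i - A)) x \<partial>M)"
      by (rule T_symmetric[OF t qa E2'])
    also have "\<dots> = 0"
    proof (rule integral_eq_zero_AE)
      show "AE x in M. \<bar>q x\<bar> * T t (indicator (E i - A)) x = 0"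
        using van by eventually_elim (auto simp: q_def indicator_def)
    qed
    finally show "AE x in M. T t (\<lambda>y. \<bar>q y\<bar>) x * indicator (E i - A) x = 0"
      using integral_nonneg_eq_0_iff_AE[OF int pos'] by simp
  qed
  with abs_T_le[OF t q] AE_space
  have "AE x in M. x \<notin> A \<longrightarrow> T t q x = 0"
  proof eventually_elim
    case (elim x)
    show ?case
    proof
      assume "x \<notin> A"
      obtain i where "x \<in> E i" using elim E(2) by auto
      with \<open>x \<notin> A\<close> elim(3) have "T t (\<lambda>y. \<bar>q y\<bar>) x = 0"
        by (metis DiffI indicator_simps(1) mult.right_neutral)
      with elim(1) show "T t q x = 0" by simp
    qed
  qed
  then show "AE x in M. x \<notin> A \<longrightarrow> T t (\<lambda>y. indicator A y * g y) x = 0"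
    unfolding q_def .
qed

text \<open>The function \<open>g\<close> splits into its parts on \<open>A\<close> and off
  \<open>A\<close>, and \<open>T t\<close> keeps each part on its own side. The splitting holds on
  \<open>space M\<close> only, hence the use of \<open>T_cong\<close>.\<close>

lemma invariant_setI:
  assumes A: "A \<in> sets M" "emeasure M A < \<infinity>"
    and fixed: "\<And>t. 0 \<le> t \<Longrightarrow> AE x in M. T t (indicator A) x = indicator A x"
  shows "invariant_set M T A"
  unfolding invariant_set_def
proof (intro conjI A allI impI)
  fix t :: real and g assume t: "0 \<le> t" and g: "memLp M 2 g"
  have m: "memLp M 2 (\<lambda>y. indicator A y * g y)" "memLp M 2 (\<lambda>y. indicator (space M - A) y * g y)"
    using A by (auto intro!: memLp2_indicator_mult g)
  have m': "memLp M 2 (\<lambda>y. 1 * (indicator A y * g y) + 1 * (indicator (space M - A) y * g y))"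
    by (rule memLp2_lincomb[OF m])
  have "AE x in M. g x = 1 * (indicator A x * g x) + 1 * (indicator (space M - A) x * g x)"
    using AE_space by eventually_elim (auto simp: indicator_def)
  then have "AE x in M. T t g x =
      T t (\<lambda>y. 1 * (indicator A y * g y) + 1 * (indicator (space M - A) y * g y)) x"
    by (rule T_cong[OF t g m'])
  with T_lincomb[OF t m, of 1 1] T_indicator_fixed_imp_T_vanishes[OF t A fixed[OF t] g]
  show "AE x in M. T t (\<lambda>y. indicator A y * g y) x = indicator A x * T t g x"
    by eventually_elim (auto simp: indicator_def)
qed

text \<open>Irreducibility leaves two options at each positive level: \<open>g\<close> is almost
  everywhere above it or almost everywhere not. At \<open>c\<close> the level set is conull, which
  gives finite measure and \<open>T t 1 = 1\<close>. At the mean value either option forces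
  equality, as \<open>g\<close> minus its mean integrates to zero.\<close>

lemma weakly_harmonic_const:
  assumes irr: "irreducible M T" and p: "1 \<le> p" and g: "weakly_harmonic p g"
    and c: "0 < c" and nonnull: "\<not> (AE x in M. g x \<le> c)"
  shows "emeasure M (space M) < \<infinity>"
    and "AE x in M. g x = (\<integral>y. g y \<partial>M) / measure M (space M)"
    and "\<And>t. 0 \<le> t \<Longrightarrow> AE x in M. T t (\<lambda>_. 1) x = 1"
proof -
  define A where "A a = {x \<in> space M. a < g x}" for a
  note lev = weakly_harmonic_level_set[OF p g, folded A_def]
  have gp: "memLp M p g" using g by (simp add: weakly_harmonic_def)
  note [measurable] = memLp_measurable[OF gp]
  have dich: "(AE x in M. g x \<le> a) \<or> (AE x in M. a < g x)" if a: "0 < a" for a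
  proof -
    have As: "A a \<in> sets M" by (rule lev[OF a order_refl])
    have "invariant_set M T (A a)"
      using lev[OF a] by (intro invariant_setI) auto
    then have "A a \<in> null_sets M \<or> space M - A a \<in> null_sets M"
      using irr As unfolding irreducible_def by (auto simp: null_sets_def)
    then have "(AE x in M. x \<notin> A a) \<or> (AE x in M. x \<notin> space M - A a)"
      using AE_not_in by blast
    then show ?thesis
    proof (elim disj_forward)
      assume "AE x in M. x \<notin> A a"
      then show "AE x in M. g x \<le> a" using AE_space by eventually_elim (auto simp: A_def)
    next
      assume "AE x in M. x \<notin> space M - A a"
      then show "AE x in M. a < g x" using AE_space by eventually_elim (auto simp: A_def)
    qed
  qed
  with c nonnull have gc: "AE x in M. c < g x" by blast
  then have Ac: "AE x in M. indicator (A c) x = (1::real)"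
    using AE_space by eventually_elim (auto simp: A_def)
  have "emeasure M (space M) = emeasure M (A c)"
    using gc AE_space lev(1)[OF c order_refl] by (intro emeasure_eq_AE) (auto simp: A_def)
  then show fin: "emeasure M (space M) < \<infinity>" using lev(2)[OF c order_refl] by simp
  then interpret finite_measure M by (intro finite_measureI) auto
  have one: "memLp M 2 (\<lambda>_. 1)" by (simp add: memLp2_iff)
  show "AE x in M. T t (\<lambda>_. 1) x = 1" if t: "0 \<le> t" for t
  proof -
    have "AE x in M. T t (indicator (A c)) x = T t (\<lambda>_. 1) x"
      using lev[OF c t] by (intro T_cong[OF t _ one Ac] memLp2_indicator)
    with lev(3)[OF c t] Ac show ?thesis by eventually_elim simp
  qed
  have int: "integrable M g"
    using memLp_mult_bounded_L1(1)[OF p gp, of "\<lambda>_. 1" 1] by simp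
  define k where "k = (\<integral>y. g y \<partial>M) / measure M (space M)"
  have "emeasure M (space M) \<noteq> 0"
  proof
    assume "emeasure M (space M) = 0"
    then have "AE x in M. g x \<le> c" by (intro AE_I[of _ _ "space M"]) auto
    with nonnull show False ..
  qed
  then have pos: "0 < measure M (space M)"
    using fin by (simp add: measure_def enn2real_positive_iff less_top zero_less_iff_neq_zero)
  have k: "(\<integral>x. g x - k \<partial>M) = 0" using int pos by (simp add: k_def)
  \<comment> \<open>The dichotomy is available at positive levels only, so the mean \<open>k\<close>
    must be shown to be positive.\<close>
  have "(\<integral>x. c \<partial>M) \<le> (\<integral>x. g x \<partial>M)"
    using gc int by (intro integral_mono_AE) auto
  then have "0 < (\<integral>x. g x \<partial>M)" using mult_pos_pos[OF c pos] by (simp add: mult.commute)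
  then have "0 < k" using pos by (simp add: k_def)
  then have "AE x in M. g x = k"
  proof (rule disjE[OF dich])
    assume le: "AE x in M. g x \<le> k"
    have "(\<integral>x. k - g x \<partial>M) = 0" using k int by simp
    moreover have "integrable M (\<lambda>x. k - g x)" using int by simp
    moreover have "AE x in M. 0 \<le> k - g x" using le by eventually_elim simp
    ultimately have "AE x in M. k - g x = 0"
      using integral_nonneg_eq_0_iff_AE by blast
    then show ?thesis by eventually_elim simp
  next
    assume le: "AE x in M. k < g x"
    have "integrable M (\<lambda>x. g x - k)" using int by simp
    moreover have "AE x in M. 0 \<le> g x - k" using le by eventually_elim simp
    ultimately have "AE x in M. g x - k = 0"
      using integral_nonneg_eq_0_iff_AE k by blast
    then show ?thesis by eventually_elim simp
  qed
  then show "AE x in M. g x = (\<integral>y. g y \<partial>M) / measure M (space M)" by (simp only: k_def)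
qed

text \<open>In finite measure the constant 1 is an admissible test function, so
  \<open>Lp_extension_symmetric\<close> with exponent 1 transfers \<open>T t 1 = 1\<close> to
  preservation of integrals.\<close>

lemma conservativeI:
  assumes fin: "emeasure M (space M) < \<infinity>"
    and T1: "\<And>t. 0 \<le> t \<Longrightarrow> AE x in M. T t (\<lambda>_. 1) x = 1"
  shows "conservative M T"
  unfolding conservative_def
proof (intro allI impI)
  fix S g and t :: real
  assume S: "Lp_extension M 1 T S" and t: "0 \<le> t" and g: "memLp M 1 g"
  interpret finite_measure M using fin by (intro finite_measureI) auto
  have "(\<integral>x. S t g x * 1 \<partial>M) = (\<integral>x. g x * T t (\<lambda>_. 1) x \<partial>M)"
    by (rule Lp_extension_symmetric[OF _ S t g, of _ 1]) auto
  also have "\<dots> = (\<integral>x. g x \<partial>M)"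
  proof (rule integral_cong_AE)
    show "AE x in M. g x * T t (\<lambda>_. 1) x = g x" using T1[OF t] by eventually_elim simp
  qed (auto intro!: borel_measurable_times T_measurable t memLp_measurable[OF g] simp: memLp2_iff)
  finally show "(\<integral>x. S t g x \<partial>M) = (\<integral>x. g x \<partial>M)" by simp
qed

end

theorem theorem1:
  fixes M :: "'a measure"
    and D :: "('a \<Rightarrow> real) set"
    and B :: "('a \<Rightarrow> real) \<Rightarrow> ('a \<Rightarrow> real) \<Rightarrow> real"
    and T Tp :: "real \<Rightarrow> ('a \<Rightarrow> real) \<Rightarrow> ('a \<Rightarrow> real)"
    and p :: real
    and f :: "'a \<Rightarrow> real"
  assumes "sigma_finite_measure M"
    and "dirichlet_form M D B"
    and "associated_semigroup M D B T"
    and "irreducible M T"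
    and "1 < p"
    and "Lp_extension M p T Tp"
    and "Lp_harmonic M p Tp f"
  shows "(if emeasure M (space M) < \<infinity> \<and> conservative M T
          then (AE x in M. f x = (\<integral>y. f y \<partial>M) / measure M (space M))
          else (AE x in M. f x = 0))
       \<and> (\<not> (AE x in M. f x = 0) \<longrightarrow> emeasure M (space M) < \<infinity>)"
proof (cases "AE x in M. f x = 0")
  case True
  \<comment> \<open>For vanishing \<open>f\<close> the mean is 0 as well, so both branches of the
    claim say the same.\<close>
  then have "(\<integral>y. f y \<partial>M) = 0" by (rule integral_eq_zero_AE)
  with True show ?thesis by simp
next
  case False
  interpret dirichlet_semigroup M T D B
    using assms by (simp add: dirichlet_semigroup_def L2_semigroup_def dirichlet_semigroup_axioms_def
        associated_semigroup_def)
  have p: "1 \<le> p" using assms by simp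
  have f: "weakly_harmonic p f" using p assms(6,7) by (rule Lp_harmonic_imp_weakly_harmonic)
  have "\<exists>n. \<not> (AE x in M. \<bar>f x\<bar> \<le> inverse (real (Suc n)))"
  proof (rule ccontr)
    assume "\<not> ?thesis"
    then have "AE x in M. \<forall>n. \<bar>f x\<bar> \<le> inverse (real (Suc n))" by (simp add: AE_all_countable)
    then have "AE x in M. f x = 0"
    proof eventually_elim
      case (elim x)
      have "\<bar>f x\<bar> \<le> 0"
        by (rule LIMSEQ_le_const[OF LIMSEQ_inverse_real_of_nat]) (use elim in auto)
      then show ?case by simp
    qed
    with False show False ..
  qed
  then obtain n where n: "\<not> (AE x in M. \<bar>f x\<bar> \<le> inverse (real (Suc n)))" ..
  define c where "c = inverse (real (Suc n))"
  have c: "0 < c" "\<not> (AE x in M. \<bar>f x\<bar> \<le> c)" using n by (simp_all add: c_def)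
  \<comment> \<open>\<open>weakly_harmonic_const\<close> needs a positive level exceeded on a
    nonnull set; either \<open>f\<close> or \<open>- f\<close> provides one, and the conclusion is
    insensitive to the sign.\<close>
  have "\<not> (AE x in M. f x \<le> c) \<or> \<not> (AE x in M. - f x \<le> c)"
  proof (rule ccontr)
    assume "\<not> ?thesis"
    then have "AE x in M. f x \<le> c" "AE x in M. - f x \<le> c" by blast+
    then have "AE x in M. \<bar>f x\<bar> \<le> c" by eventually_elim auto
    with c(2) show False ..
  qed
  then have "emeasure M (space M) < \<infinity> \<and> (AE x in M. f x = (\<integral>y. f y \<partial>M) / measure M (space M)) \<and>
      (\<forall>t\<ge>0. AE x in M. T t (\<lambda>_. 1) x = 1)"
  proof
    assume "\<not> (AE x in M. f x \<le> c)"
    from weakly_harmonic_const[OF assms(4) p f c(1) this] show ?thesis by simp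
  next
    assume "\<not> (AE x in M. - f x \<le> c)"
    from weakly_harmonic_const[OF assms(4) p weakly_harmonic_uminus[OF f] c(1) this] show ?thesis
      by simp
  qed
  then show ?thesis using conservativeI by auto
qed

end
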